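(* (Parke–Taylor formula.) Let $N\ge1$, $I=N+1$, $J=N+2$. The tree-level Yang–Mills MHV amplitude for $N$ positive helicity gluons $1,\dots,N$ and two negative helicity gluons $I,J$, defined from the on-shell action by $$\mathcal A_{\rm MHV}=-4\mathrm i\,\frac{\partial^{N+2}}{\partial\epsilon_1\cdots\partial\epsilon_{N+2}}\int d^4X\;\mathrm{Tr}\big((f^I)^{AB}(f^J)_{AB}\big)\Big|_{\epsilon=0},$$ equals $$\mathcal A_{\rm MHV}=\mathrm i(2\pi)^4\delta^{(4)}\Big(\sum_{i=1}^{N+2}p_i\Big)\langle IJ\rangle^4\sum_{\sigma\in \mathrm{Sym}(N+2)/\mathbb Z_{N+2}}\frac{\mathrm{Tr}\big(\mathbf T^{a_{\sigma(1)}}\cdots\mathbf T^{a_{\sigma(N+2)}}\big)}{\langle\sigma(1)\sigma(2)\rangle\langle\sigma(2)\sigma(3)\rangle\cdots\langle\sigma(N+2)\sigma(1)\rangle}.$$ Equivalently, the coefficient of $\epsilon_1\cdots\epsilon_{N+2}$ in $-4\mathrm i\,\mathrm{Tr}((f^I)^{AB}(f^J)_{AB})$ is $\mathrm i\,e^{\mathrm i\sum_ip_i\cdot X}$ times $\langle IJ\rangle^4$ times the displayed sum over cyclic orderings.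
   Context: Coordinates $u,\bar u,w,\bar w$ are independent light-cone coordinates. For $i=1,\dots,N+2$ fix $\omega_i\ne0,z_i,\bar z_i$ with pairwise distinct $z_i$; $z_{ij}=z_i-z_j$, $\langle ij\rangle=z_{ij}$, $p_i\cdot X=\omega_i(u+z_i\bar z_i\bar u-\bar z_iw-z_i\bar w)$. Commuting parameters $\epsilon_i$ satisfy $\epsilon_i^2=0$. $\mathbf T^{a}$ are matrices in a matrix representation of the gauge Lie algebra $\mathfrak g$, $\mathrm{Tr}$ is the matrix trace, and the seed functions are $\Phi_i=\epsilon_i\mathbf T^{a_i}e^{\mathrm ip_i\cdot X}$. Perturbiner of the Chalmers–Siegel scalar (self-dual Yang–Mills): for a finite index set $S$, $$\Phi(\{\Phi_i\}_{i\in S})=\sum_{k\ge1}\ \sum_{(s_1,\dots,s_k)}\frac{\Phi_{s_1}\Phi_{s_2}\cdots\Phi_{s_k}}{z_{s_1s_2}z_{s_2s_3}\cdots z_{s_{k-1}s_k}},$$ the inner sum over all ordered $k$-tuples of distinct elements of $S$. Put $\Phi(\Phi_1,\dots,\Phi_N|\Phi_I)=\Phi(\Phi_1,\dots,\Phi_N,\Phi_I)-\Phi(\Phi_1,\dots,\Phi_N)$ (the sum of all terms containing $\Phi_I$), and similarly for $J$. The linearized anti-self-dual field strength of the negative helicity gluon $I$ on the self-dual background of the $N$ positive helicity gluons is $$f^I_{AB}=\tfrac12\kappa^I_A\kappa^I_B\,\Phi(\Phi_1,\dots,\Phi_N|\Phi_I),\qquad \kappa^I_A=(-z_I,1),$$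 and similarly for $J$. Spinor indices are raised with $\lambda^A=\varepsilon^{AB}\lambda_B$, $\varepsilon^{12}=1$. The amplitude arises from the action $S=-2\int d^4X\,\mathrm{Tr}(F^{AB}F_{AB})$ (Yang–Mills plus topological term), with $\int d^4X\,e^{\mathrm iP\cdot X}=(2\pi)^4\delta^{(4)}(P)$. The quotient $\mathrm{Sym}(N+2)/\mathbb Z_{N+2}$ denotes orderings of $1,\dots,N+2$ modulo cyclic rotation. *)

theory Defs
  imports "HOL-Analysis.Analysis" "HOL-Combinatorics.Multiset_Permutations"
begin

section \<open>The algebra of commuting parameters with square zero\<close>

text \<open>
  An element is the family of its coefficients: the finite set \<open>S\<close> stands for the monomial
  \<open>\<Prod>i\<in>S. \<epsilon>\<^sub>i\<close>. Since \<open>\<epsilon>\<^sub>i\<^sup>2 = 0\<close>, the product of the monomials of \<open>S\<close> and \<open>T\<close> is the monomial of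
  \<open>S \<union> T\<close> if \<open>S\<close> and \<open>T\<close> are disjoint, and zero otherwise.
\<close>

typedef eps = "{f :: nat set \<Rightarrow> complex. \<forall>S. infinite S \<longrightarrow> f S = 0}"
  morphisms eps_coeff Abs_eps
  by (rule exI[of _ "\<lambda>_. 0"]) simp

definition mk_eps :: "(nat set \<Rightarrow> complex) \<Rightarrow> eps" where
  "mk_eps f = Abs_eps (\<lambda>S. if finite S then f S else 0)"

lemma eps_coeff_mk [simp]: "eps_coeff (mk_eps f) S = (if finite S then f S else 0)"
  unfolding mk_eps_def by (subst Abs_eps_inverse) auto

lemma eps_coeff_infinite [simp]: "infinite S \<Longrightarrow> eps_coeff x S = 0"
  using eps_coeff[of x] by auto

lemma eps_eqI: "(\<And>S. finite S \<Longrightarrow> eps_coeff x S = eps_coeff y S) \<Longrightarrow> x = y"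
  by (metis eps_coeff_infinite eps_coeff_inject ext)

instantiation eps :: comm_ring_1
begin

definition zero_eps :: eps where "0 = mk_eps (\<lambda>_. 0)"
definition one_eps :: eps where "1 = mk_eps (\<lambda>S. if S = {} then 1 else 0)"
definition plus_eps :: "eps \<Rightarrow> eps \<Rightarrow> eps" where
  "x + y = mk_eps (\<lambda>S. eps_coeff x S + eps_coeff y S)"
definition minus_eps :: "eps \<Rightarrow> eps \<Rightarrow> eps" where
  "x - y = mk_eps (\<lambda>S. eps_coeff x S - eps_coeff y S)"
definition uminus_eps :: "eps \<Rightarrow> eps" where
  "- x = mk_eps (\<lambda>S. - eps_coeff x S)"
definition times_eps :: "eps \<Rightarrow> eps \<Rightarrow> eps" where
  "x * y = mk_eps (\<lambda>S. \<Sum>T\<in>Pow S. eps_coeff x T * eps_coeff y (S - T))"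

instance
proof
  fix a b c :: eps
  show "a * b * c = a * (b * c)"
  proof (rule eps_eqI)
    fix S :: "nat set" assume S: "finite S"
    let ?a = "eps_coeff a" and ?b = "eps_coeff b" and ?c = "eps_coeff c"
    have sub: "finite T" if "T \<subseteq> S" for T using that S finite_subset by blast
    have "eps_coeff (a * b * c) S =
      (\<Sum>T\<in>Pow S. \<Sum>U\<in>Pow T. ?a U * ?b (T - U) * ?c (S - T))"
      using S sub by (auto simp: times_eps_def sum_distrib_right intro!: sum.cong)
    also have "\<dots> = (\<Sum>(T,U)\<in>Sigma (Pow S) Pow. ?a U * ?b (T - U) * ?c (S - T))"
      using S sub by (subst sum.Sigma) auto
    also have "\<dots> = (\<Sum>(U,V)\<in>Sigma (Pow S) (\<lambda>U. Pow (S - U)). ?a U * (?b V * ?c (S - U - V)))"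
    proof (rule sum.reindex_bij_witness[of _ "\<lambda>(U,V). (U \<union> V, U)" "\<lambda>(T,U). (U, T - U)"],
        goal_cases)
      case (5 x)
      obtain T U where x: "x = (T, U)" by (cases x)
      with 5 have "S - U - (T - U) = S - T" by auto
      with x show ?case by (simp add: mult.assoc)
    qed auto
    also have "\<dots> = (\<Sum>U\<in>Pow S. \<Sum>V\<in>Pow (S - U). ?a U * (?b V * ?c (S - U - V)))"
      using S sub by (subst sum.Sigma) auto
    also have "\<dots> = eps_coeff (a * (b * c)) S"
      using S by (auto simp: times_eps_def sum_distrib_left intro!: sum.cong)
    finally show "eps_coeff (a * b * c) S = eps_coeff (a * (b * c)) S" .
  qed
  show "a * b = b * a"
  proof (rule eps_eqI)
    fix S :: "nat set" assume S: "finite S"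
    have "(\<Sum>T\<in>Pow S. eps_coeff a T * eps_coeff b (S - T)) =
          (\<Sum>T\<in>Pow S. eps_coeff b T * eps_coeff a (S - T))"
      by (rule sum.reindex_bij_witness[of _ "\<lambda>T. S - T" "\<lambda>T. S - T"])
         (auto simp: double_diff)
    then show "eps_coeff (a * b) S = eps_coeff (b * a) S"
      using S by (simp add: times_eps_def)
  qed
  show "1 * a = a"
  proof (rule eps_eqI)
    fix S :: "nat set" assume S: "finite S"
    have "eps_coeff (1 * a) S = (\<Sum>T\<in>Pow S. eps_coeff 1 T * eps_coeff a (S - T))"
      using S by (simp add: times_eps_def)
    also have "\<dots> = (\<Sum>T\<in>Pow S. if T = {} then eps_coeff a S else 0)"
      by (rule sum.cong) (auto simp: one_eps_def)
    also have "\<dots> = eps_coeff a S" using S by simp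
    finally show "eps_coeff (1 * a) S = eps_coeff a S" .
  qed
  show "(a + b) * c = a * c + b * c"
  proof (rule eps_eqI)
    fix S :: "nat set" assume S: "finite S"
    then have "finite T" if "T \<subseteq> S" for T using that finite_subset by blast
    with S show "eps_coeff ((a + b) * c) S = eps_coeff (a * c + b * c) S"
      by (auto simp: times_eps_def plus_eps_def sum.distrib [symmetric] distrib_right
          intro!: sum.cong)
  qed
  show "(0::eps) \<noteq> 1"
  proof
    assume "(0::eps) = 1"
    then have "eps_coeff 0 {} = eps_coeff 1 {}" by simp
    then show False by (simp add: zero_eps_def one_eps_def)
  qed
qed (auto intro!: eps_eqI simp: plus_eps_def minus_eps_def uminus_eps_def zero_eps_def)

end

definition eps_const :: "complex \<Rightarrow> eps" where
  "eps_const c = mk_eps (\<lambda>S. if S = {} then c else 0)"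

definition eps_var :: "nat \<Rightarrow> eps" where
  "eps_var i = mk_eps (\<lambda>S. if S = {i} then 1 else 0)"

lemma eps_var_square: "eps_var i * eps_var i = 0"
proof (rule eps_eqI)
  fix S :: "nat set" assume S: "finite S"
  then have "finite T" if "T \<subseteq> S" for T using that finite_subset by blast
  with S show "eps_coeff (eps_var i * eps_var i) S = eps_coeff 0 S"
    by (auto simp: times_eps_def eps_var_def zero_eps_def intro!: sum.neutral)
qed

definition eps_deriv :: "nat \<Rightarrow> eps \<Rightarrow> eps" where
  "eps_deriv i x = mk_eps (\<lambda>S. if i \<in> S then 0 else eps_coeff x (insert i S))"

definition eps_at_zero :: "eps \<Rightarrow> complex" where
  "eps_at_zero x = eps_coeff x {}"


section \<open>Matrices\<close>

definition mat_scale :: "'a::semiring_1 \<Rightarrow> 'a^'r^'r \<Rightarrow> 'a^'r^'r" where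
  "mat_scale c M = (\<chi> r s. c * M $ r $ s)"

definition mat_prod_list :: "('a::semiring_1^'r^'r) list \<Rightarrow> 'a^'r^'r" where
  "mat_prod_list Ms = foldr (**) Ms (mat 1)"

definition lie_bracket :: "('g::real_vector \<Rightarrow> 'g \<Rightarrow> 'g) \<Rightarrow> bool" where
  "lie_bracket br \<longleftrightarrow>
     (\<forall>x. linear (br x)) \<and> (\<forall>y. linear (\<lambda>x. br x y)) \<and> (\<forall>x. br x x = 0) \<and>
     (\<forall>x y z. br x (br y z) + br y (br z x) + br z (br x y) = 0)"

definition lie_representation ::
  "('g::real_vector \<Rightarrow> 'g \<Rightarrow> 'g) \<Rightarrow> ('g \<Rightarrow> complex^'r^'r) \<Rightarrow> bool" where
  "lie_representation br \<rho> \<longleftrightarrow>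
     linear \<rho> \<and> (\<forall>x y. \<rho> (br x y) = \<rho> x ** \<rho> y - \<rho> y ** \<rho> x)"


section \<open>Seed functions, perturbiner and linearised field strength\<close>

text \<open>A point \<open>X = (u, ubar, w, wbar)\<close> in independent light-cone coordinates.\<close>
type_synonym lightcone = "complex \<times> complex \<times> complex \<times> complex"

text \<open>The external data \<open>(\<omega>\<^sub>i, z\<^sub>i, zbar\<^sub>i)\<close> of one gluon are passed as three separate arguments.\<close>
definition mom_dot :: "complex \<Rightarrow> complex \<Rightarrow> complex \<Rightarrow> lightcone \<Rightarrow> complex" where
  "mom_dot \<omega> z zb X =
     (case X of (u, ub, w, wb) \<Rightarrow> \<omega> * (u + z * zb * ub - zb * w - z * wb))"

definition seed ::
  "(nat \<Rightarrow> complex) \<Rightarrow> (nat \<Rightarrow> complex) \<Rightarrow> (nat \<Rightarrow> complex) \<Rightarrow> (nat \<Rightarrow> complex^'r^'r) \<Rightarrow>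
   lightcone \<Rightarrow> nat \<Rightarrow> eps^'r^'r" where
  "seed \<omega> z zb T X i =
     mat_scale (eps_var i * eps_const (exp (\<i> * mom_dot (\<omega> i) (z i) (zb i) X)))
       (\<chi> r s. eps_const (T i $ r $ s))"

definition spb :: "(nat \<Rightarrow> complex) \<Rightarrow> nat \<Rightarrow> nat \<Rightarrow> complex" where
  "spb z i j = z i - z j"

definition open_chain :: "(nat \<Rightarrow> complex) \<Rightarrow> nat list \<Rightarrow> complex" where
  "open_chain z s = (\<Prod>j<length s - 1. spb z (s ! j) (s ! Suc j))"

definition perturbiner ::
  "(nat \<Rightarrow> complex) \<Rightarrow> (nat \<Rightarrow> eps^'r^'r) \<Rightarrow> nat set \<Rightarrow> eps^'r^'r" where
  "perturbiner z \<Phi> S =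
     (\<Sum>k=1..card S. \<Sum>s\<in>{s. length s = k \<and> distinct s \<and> set s \<subseteq> S}.
        mat_scale (eps_const (1 / open_chain z s)) (mat_prod_list (map \<Phi> s)))"

text \<open>\<open>\<Phi>(\<Phi>\<^sub>1, \<dots>, \<Phi>\<^sub>N | \<Phi>\<^sub>I)\<close>\<close>
definition perturbiner_ins ::
  "(nat \<Rightarrow> complex) \<Rightarrow> (nat \<Rightarrow> eps^'r^'r) \<Rightarrow> nat \<Rightarrow> nat \<Rightarrow> eps^'r^'r" where
  "perturbiner_ins z \<Phi> N I = perturbiner z \<Phi> (insert I {1..N}) - perturbiner z \<Phi> {1..N}"

definition spinor :: "complex \<Rightarrow> complex^2" where
  "spinor z = vector [- z, 1]"

definition field_strength ::
  "(nat \<Rightarrow> complex) \<Rightarrow> (nat \<Rightarrow> eps^'r^'r) \<Rightarrow> nat \<Rightarrow> nat \<Rightarrow> 2 \<Rightarrow> 2 \<Rightarrow> eps^'r^'r" where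
  "field_strength z \<Phi> N I A B =
     mat_scale (eps_const (1/2 * spinor (z I) $ A * spinor (z I) $ B)) (perturbiner_ins z \<Phi> N I)"

definition levi_civita :: "2 \<Rightarrow> 2 \<Rightarrow> complex" where
  "levi_civita A B = (if A = 1 \<and> B = 2 then 1 else if A = 2 \<and> B = 1 then - 1 else 0)"

definition raise_indices :: "(2 \<Rightarrow> 2 \<Rightarrow> eps^'r^'r) \<Rightarrow> 2 \<Rightarrow> 2 \<Rightarrow> eps^'r^'r" where
  "raise_indices f A B =
     (\<Sum>C\<in>UNIV. \<Sum>D\<in>UNIV. mat_scale (eps_const (levi_civita A C * levi_civita B D)) (f C D))"

text \<open>\<open>Tr((f\<^sup>I)\<^sup>A\<^sup>B (f\<^sup>J)\<^sub>A\<^sub>B)\<close> at the point \<open>X\<close>, with \<open>I = N + 1\<close> and \<open>J = N + 2\<close>\<close>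
definition mhv_density ::
  "(nat \<Rightarrow> complex) \<Rightarrow> (nat \<Rightarrow> complex) \<Rightarrow> (nat \<Rightarrow> complex) \<Rightarrow> (nat \<Rightarrow> complex^'r^'r) \<Rightarrow>
   nat \<Rightarrow> lightcone \<Rightarrow> eps" where
  "mhv_density \<omega> z zb T N X =
     (let \<Phi> = seed \<omega> z zb T X;
          fI = field_strength z \<Phi> N (N + 1);
          fJ = field_strength z \<Phi> N (N + 2)
      in trace (\<Sum>A\<in>UNIV. \<Sum>B\<in>UNIV. raise_indices fI A B ** fJ A B))"


section \<open>Spacetime integrals as distributions\<close>

text \<open>
  A real form of the complexified space of light-cone coordinates, given by real linear coordinates
  \<open>x\<close> on it. Examples: all of \<open>u, ubar, w, wbar\<close> real (split signature), or \<open>u, ubar\<close> real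
  and \<open>wbar\<close> the complex conjugate of \<open>w\<close> (Lorentzian signature). The last condition says that
  the complex span of the real form is everything.
\<close>
definition real_form :: "(real^4 \<Rightarrow> lightcone) \<Rightarrow> bool" where
  "real_form \<iota> \<longleftrightarrow> linear \<iota> \<and>
     (\<forall>a b c d. (\<forall>x. case \<iota> x of (u, ub, w, wb) \<Rightarrow> a * u + b * ub + c * w + d * wb = 0)
        \<longrightarrow> a = 0 \<and> b = 0 \<and> c = 0 \<and> d = 0)"

lemma real_form_split_signature:
  "real_form (\<lambda>x. (of_real (x $ 1), of_real (x $ 2), of_real (x $ 3), of_real (x $ 4)))"
  (is "real_form ?\<iota>")
proof -
  have "linear ?\<iota>" by (rule linearI) (simp_all add: scaleR_conv_of_real [where 'a = complex])
  moreover have "a = 0 \<and> b = 0 \<and> c = 0 \<and> d = 0"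
    if h: "\<forall>x. case ?\<iota> x of (u, ub, w, wb) \<Rightarrow> a * u + b * ub + c * w + d * wb = 0"
    for a b c d :: complex
    using h[rule_format, of "axis 1 1"] h[rule_format, of "axis 2 1"]
      h[rule_format, of "axis 3 1"] h[rule_format, of "axis 4 1"]
    by (simp add: axis_def)
  ultimately show ?thesis unfolding real_form_def by blast
qed

definition fourier :: "(real^4 \<Rightarrow> complex) \<Rightarrow> real^4 \<Rightarrow> complex" where
  "fourier \<psi> x = (\<integral>q. \<psi> q * exp (- \<i> * of_real (q \<bullet> x)) \<partial>lborel)"

text \<open>
  Test functions on momentum space: a class large enough to contain all Schwartz functions, on
  which both \<open>spacetime_integral\<close> below and evaluation at a point are defined.
\<close>
definition test_function :: "(real^4 \<Rightarrow> complex) \<Rightarrow> bool" where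
  "test_function \<psi> \<longleftrightarrow>
     continuous_on UNIV \<psi> \<and> integrable lborel \<psi> \<and> integrable lborel (fourier \<psi>)"

text \<open>
  The integral of a bounded function \<open>h\<close> over spacetime, such as a plane wave, does not converge.
  It is read as usual as the distribution \<open>\<integral> h(x) exp(- i q\<cdot>x) d\<^sup>4x\<close> in a momentum \<open>q\<close>, that is, as
  the functional that integrates \<open>h\<close> against the Fourier transform of the test function
  \<open>\<psi>(q)\<close>. The integral of a function with values in \<open>eps\<close> is taken coefficientwise.
\<close>
definition spacetime_integral :: "(real^4 \<Rightarrow> eps) \<Rightarrow> (real^4 \<Rightarrow> complex) \<Rightarrow> eps" where
  "spacetime_integral h \<psi> = mk_eps (\<lambda>S. \<integral>x. eps_coeff (h x) S * fourier \<psi> x \<partial>lborel)"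

text \<open>
  \<open>\<delta>(P - q)\<close> as a distribution in \<open>q\<close>; in these conventions
  \<open>\<integral> exp(i P\<cdot>x) d\<^sup>4x = (2\<pi>)\<^sup>4 \<delta>(P)\<close> is the Fourier inversion theorem.
\<close>
definition delta4 :: "real^4 \<Rightarrow> (real^4 \<Rightarrow> complex) \<Rightarrow> complex" where
  "delta4 P \<psi> = \<psi> P"

definition mhv_amplitude ::
  "(nat \<Rightarrow> complex) \<Rightarrow> (nat \<Rightarrow> complex) \<Rightarrow> (nat \<Rightarrow> complex) \<Rightarrow> (nat \<Rightarrow> complex^'r^'r) \<Rightarrow>
   nat \<Rightarrow> (real^4 \<Rightarrow> lightcone) \<Rightarrow> (real^4 \<Rightarrow> complex) \<Rightarrow> complex" where
  "mhv_amplitude \<omega> z zb T N \<iota> \<psi> =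
     - 4 * \<i> * eps_at_zero (foldr eps_deriv [1..<N + 3]
       (spacetime_integral (\<lambda>x. mhv_density \<omega> z zb T N (\<iota> x)) \<psi>))"


section \<open>The sum over cyclic orderings\<close>

definition closed_chain :: "(nat \<Rightarrow> complex) \<Rightarrow> nat list \<Rightarrow> complex" where
  "closed_chain z s = (\<Prod>j<length s. spb z (s ! j) (s ! (Suc j mod length s)))"

text \<open>An ordering of \<open>1, \<dots>, n\<close> is the list \<open>[\<sigma>(1), \<dots>, \<sigma>(n)]\<close>.\<close>
definition cyclic_orderings :: "nat \<Rightarrow> nat list set set" where
  "cyclic_orderings n =
     permutations_of_set {1..n} // {(s, s'). s \<in> permutations_of_set {1..n} \<and> (\<exists>k. s' = rotate k s)}"

text \<open>The summand does not depend on the representative, as the trace is cyclic.\<close>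
definition parke_taylor_sum ::
  "(nat \<Rightarrow> complex) \<Rightarrow> (nat \<Rightarrow> complex^'r^'r) \<Rightarrow> nat \<Rightarrow> complex" where
  "parke_taylor_sum z T n =
     (\<Sum>c\<in>cyclic_orderings n. let s = SOME s. s \<in> c in
        trace (mat_prod_list (map T s)) / closed_chain z s)"

end

theory Submission
  imports Defs "HOL-Probability.Characteristic_Functions"
begin

text \<open>
  The contraction of the spinors gives \<open>\<langle>IJ\<rangle>\<^sup>2 / 4\<close>. What remains are pairs of words \<open>s \<ni> I\<close> and
  \<open>s' \<ni> J\<close> which together use every gluon once. Such a pair is a cyclic ordering together with one
  cut of the arc from \<open>I\<close> to \<open>J\<close> and one cut of the arc from \<open>J\<close> to \<open>I\<close>, and the weight of the pair
  is the Parke-Taylor factor of the cyclic ordering times the differences \<open>\<langle>ij\<rangle>\<close> at the two cut edges.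
  Summed over the cuts these differences telescope to \<open>\<langle>IJ\<rangle> \<langle>JI\<rangle> = - \<langle>IJ\<rangle>\<^sup>2\<close>. The spacetime integral is
  Fourier inversion, proved with Gaussian regularisation.
\<close>

section \<open>Chains and cyclic orderings\<close>

lemma open_chain_simps [simp]:
  "open_chain z [] = 1" "open_chain z [x] = 1"
  "open_chain z (x # y # s) = spb z x y * open_chain z (y # s)"
  by (simp_all add: open_chain_def prod.lessThan_Suc_shift del: prod.lessThan_Suc)

text \<open>A chain is a product over edges. Cutting at a vertex that both pieces keep distributes
  the edges and loses none.\<close>

lemma open_chain_append:
  "open_chain z (xs @ a # ys) = open_chain z (xs @ [a]) * open_chain z (a # ys)"
proof (induction xs)
  case (Cons x xs)
  then show ?case by (cases xs) simp_all
qed simp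

text \<open>Repeating the first letter at the end turns the closing edge into an ordinary one, so
  closed chains inherit the cutting rule of open chains.\<close>

lemma closed_chain_Cons: "closed_chain z (x # s) = open_chain z (x # s @ [x])"
  unfolding closed_chain_def open_chain_def
proof (rule prod.cong)
  fix j assume "j \<in> {..<length (x # s @ [x]) - 1}"
  then have j: "j < Suc (length s)" by simp
  have "(x # s @ [x]) ! j = (x # s) ! j"
    using j nth_append[of "x # s" "[x]" j] by simp
  moreover have "(x # s @ [x]) ! Suc j = (x # s) ! (Suc j mod length (x # s))"
    using j nth_append[of "x # s" "[x]" "Suc j"] by (cases "j = length s") simp_all
  ultimately show "spb z ((x # s) ! j) ((x # s) ! (Suc j mod length (x # s))) =
      spb z ((x # s @ [x]) ! j) ((x # s @ [x]) ! Suc j)" by simp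
qed simp

lemma closed_chain_two_arcs:
  "closed_chain z (x # A @ y # B) = open_chain z (x # A @ [y]) * open_chain z (y # B @ [x])"
  using open_chain_append[of z "x # A" y "B @ [x]"] by (simp add: closed_chain_Cons)

text \<open>A rotation by one step only moves the first edge to the end, where it becomes the
  closing edge.\<close>

lemma closed_chain_rotate [simp]: "closed_chain z (rotate k s) = closed_chain z s"
proof -
  have "closed_chain z (rotate1 s) = closed_chain z s" for s
  proof (cases s)
    case (Cons x xs)
    show ?thesis
    proof (cases xs)
      case Nil
      with Cons show ?thesis by simp
    next
      case (Cons y ys)
      with \<open>s = x # xs\<close> show ?thesis
        using open_chain_append[of z "y # ys" x "[y]"] by (simp add: closed_chain_Cons)
    qed
  qed simp
  then show ?thesis by (induction k) simp_all
qed

lemma open_chain_nonzero: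
  "inj_on z S \<Longrightarrow> distinct s \<Longrightarrow> set s \<subseteq> S \<Longrightarrow> open_chain z s \<noteq> 0"
proof (induction s rule: induct_list012)
  case (3 x y s)
  then show ?case by (auto simp: spb_def dest: inj_onD)
qed simp_all

text \<open>Each step of the induction is the identity \<open>z\<^sub>x\<^sub>a + z\<^sub>a\<^sub>y = z\<^sub>x\<^sub>y\<close> on the edges of the chain.\<close>
lemma sum_cut_open_chain:
  assumes "open_chain z (x # A @ [y]) \<noteq> 0"
  shows "(\<Sum>k\<le>length A. 1 / (open_chain z (x # take k A) * open_chain z (drop k A @ [y]))) =
    spb z x y / open_chain z (x # A @ [y])"
  using assms
proof (induction A arbitrary: x)
  case (Cons a A)
  then have nz: "open_chain z (a # A @ [y]) \<noteq> 0" "spb z x a \<noteq> 0" by auto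
  \<comment> \<open>The cut \<open>k = 0\<close> separates \<open>x\<close> from \<open>a\<close>
    and so lacks the edge between them. Every other cut keeps this edge and is a cut of the shorter
    chain from \<open>a\<close> to \<open>y\<close>.\<close>
  have "(\<Sum>k\<le>length (a # A). 1 / (open_chain z (x # take k (a # A)) * open_chain z (drop k (a # A) @ [y]))) =
    1 / open_chain z (a # A @ [y]) +
    (\<Sum>k\<le>length A. 1 / (open_chain z (a # take k A) * open_chain z (drop k A @ [y]))) / spb z x a"
    by (simp only: list.size add_Suc_right add_0_right sum.atMost_Suc_shift)
      (simp add: sum_divide_distrib mult_ac)
  also have "\<dots> = (spb z x a + spb z a y) / (spb z x a * open_chain z (a # A @ [y]))"
    using nz by (simp only: Cons.IH[OF nz(1)]) (simp add: field_simps)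
  finally show ?case by (simp add: spb_def)
qed simp

section \<open>Traces of ordered matrix products\<close>

lemma mat_prod_list_Nil [simp]: "mat_prod_list [] = mat 1"
  and mat_prod_list_Cons [simp]: "mat_prod_list (M # Ms) = M ** mat_prod_list Ms"
  by (simp_all add: mat_prod_list_def)

lemma mat_prod_list_append:
  "mat_prod_list (Ms @ Ns) = mat_prod_list Ms ** mat_prod_list Ns"
  by (induction Ms) (simp_all add: matrix_mul_assoc)

lemma trace_mat_prod_list_swap:
  fixes Ms Ns :: "('a::comm_semiring_1^'n^'n) list"
  shows "trace (mat_prod_list (Ms @ Ns)) = trace (mat_prod_list (Ns @ Ms))"
  unfolding mat_prod_list_append by (rule trace_mul_sym)

text \<open>A rotation exchanges a prefix with the remaining suffix, which is one application of the
  cyclicity of the trace.\<close>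

lemma trace_mat_prod_list_rotate:
  fixes Ms :: "('a::comm_semiring_1^'n^'n) list"
  shows "trace (mat_prod_list (rotate k Ms)) = trace (mat_prod_list Ms)"
  by (metis append_take_drop_id rotate_drop_take trace_mat_prod_list_swap)

text \<open>Encodes a cyclic ordering without choosing from a class: rotated to start at
  \<open>x\<close>, it consists of the arc \<open>A\<close> from \<open>x\<close> to
  \<open>y\<close> and the arc \<open>B\<close> from \<open>y\<close> back to
  \<open>x\<close>.\<close>

definition arcs :: "nat \<Rightarrow> nat \<Rightarrow> nat \<Rightarrow> (nat list \<times> nat list) set" where
  "arcs n x y = {(A, B). x # A @ y # B \<in> permutations_of_set {1..n}}"

text \<open>These pairs index the terms of the product of the two insertions that reach the top
  monomial.\<close>

definition splits :: "nat \<Rightarrow> nat \<Rightarrow> nat \<Rightarrow> (nat list \<times> nat list) set" where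
  "splits n x y = {(s, s'). s @ s' \<in> permutations_of_set {1..n} \<and> x \<in> set s \<and> y \<in> set s'}"

lemma takeWhile_dropWhile_distinct:
  assumes "x \<notin> set xs"
  shows "takeWhile (\<lambda>i. i \<noteq> x) (xs @ x # ys) = xs" "dropWhile (\<lambda>i. i \<noteq> x) (xs @ x # ys) = x # ys"
  using assms by (simp_all add: takeWhile_append dropWhile_append)

lemma finite_arcs: "finite (arcs n x y)"
proof -
  have "arcs n x y \<subseteq> {A. set A \<subseteq> {1..n} \<and> length A \<le> n} \<times> {A. set A \<subseteq> {1..n} \<and> length A \<le> n}"
  proof (rule subrelI)
    fix A B assume "(A, B) \<in> arcs n x y"
    then have "set (x # A @ y # B) = {1..n}" "distinct (x # A @ y # B)"
      by (auto simp: arcs_def permutations_of_set_def)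
    moreover from distinct_card[OF this(2), unfolded this(1)] have "length (x # A @ y # B) = n" by simp
    ultimately show "(A, B) \<in> {A. set A \<subseteq> {1..n} \<and> length A \<le> n} \<times> {A. set A \<subseteq> {1..n} \<and> length A \<le> n}"
      by auto
  qed
  then show ?thesis
    by (rule finite_subset) (intro finite_cartesian_product finite_lists_length_le; simp)
qed

text \<open>Gluing the end of each word to the start of the other gives a cyclic word. The pair is
  recovered from it by the two places of gluing: \<open>k\<close> letters of \<open>A\<close> stay
  behind \<open>x\<close>, and \<open>l\<close> letters of \<open>B\<close> stay behind
  \<open>y\<close>.\<close>

lemma sum_splits:
  fixes f :: "nat list \<Rightarrow> nat list \<Rightarrow> 'a::comm_monoid_add"
  shows "(\<Sum>(s, s')\<in>splits n x y. f s s') =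
    (\<Sum>(A, B)\<in>arcs n x y. \<Sum>k\<le>length A. \<Sum>l\<le>length B.
      f (drop l B @ x # take k A) (drop k A @ y # take l B))"
proof -
  let ?P = "Sigma (arcs n x y) (\<lambda>(A, B). {..length A} \<times> {..length B})"
  let ?t = "\<lambda>x s. takeWhile (\<lambda>i. i \<noteq> x) s" and ?d = "\<lambda>x s. tl (dropWhile (\<lambda>i. i \<noteq> x) s)"
  have "(\<Sum>(s, s')\<in>splits n x y. f s s') =
    (\<Sum>((A, B), k, l)\<in>?P. f (drop l B @ x # take k A) (drop k A @ y # take l B))"
  \<comment> \<open>In the inverse map, what follows \<open>x\<close> in \<open>s\<close> and what
    precedes \<open>y\<close> in \<open>s'\<close> join to the arc \<open>A\<close>, and
    symmetrically for \<open>B\<close>. The lengths of the two tails are the cut positions.\<close>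
  proof (rule sum.reindex_bij_witness[of _
      "\<lambda>((A, B), k, l). (drop l B @ x # take k A, drop k A @ y # take l B)"
      "\<lambda>(s, s'). ((?d x s @ ?t y s', ?d y s' @ ?t x s), length (?d x s), length (?d y s'))"],
      goal_cases)
    case (1 p)
    then obtain s1 s2 t1 t2 where p: "p = (s1 @ x # s2, t1 @ y # t2)"
      by (auto simp: splits_def dest!: split_list)
    with 1 have "x \<notin> set s1" "y \<notin> set t1" by (auto simp: splits_def permutations_of_set_def)
    then show ?case by (simp add: p takeWhile_dropWhile_distinct)
  next
    case (2 p)
    then obtain s1 s2 t1 t2 where p: "p = (s1 @ x # s2, t1 @ y # t2)"
      by (auto simp: splits_def dest!: split_list)
    with 2 have "x \<notin> set s1" "y \<notin> set t1" by (auto simp: splits_def permutations_of_set_def)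
    with 2 show ?case
      by (simp add: p takeWhile_dropWhile_distinct)
        (auto simp: arcs_def splits_def permutations_of_set_def)
  next
    case (3 q)
    then obtain A B k l where q: "q = ((A, B), k, l)" "(A, B) \<in> arcs n x y" "k \<le> length A" "l \<le> length B"
      by auto
    then have "x \<notin> set B" "y \<notin> set A" by (auto simp: arcs_def permutations_of_set_def)
    then have "x \<notin> set (drop l B)" "y \<notin> set (drop k A)" by (meson in_set_dropD)+
    with q show ?case by (simp add: takeWhile_dropWhile_distinct)
  next
    case (4 q)
    then obtain A B k l where q: "q = ((A, B), k, l)" "(A, B) \<in> arcs n x y" "k \<le> length A" "l \<le> length B"
      by auto
    \<comment> \<open>Cutting and gluing only reorders the letters, so equality of multisets carries
      over both the set of letters and distinctness.\<close>
    have "mset (x # (take k A @ drop k A) @ y # (take l B @ drop l B)) =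
        mset ((drop l B @ x # take k A) @ drop k A @ y # take l B)"
      by (simp only: mset.simps mset_append) (simp add: ac_simps)
    then have "mset (x # A @ y # B) = mset ((drop l B @ x # take k A) @ drop k A @ y # take l B)"
      by simp
    then have "set ((drop l B @ x # take k A) @ drop k A @ y # take l B) = set (x # A @ y # B)"
      "distinct ((drop l B @ x # take k A) @ drop k A @ y # take l B) = distinct (x # A @ y # B)"
      by (metis mset_eq_setD, metis mset_eq_imp_distinct_iff)
    with q(2) have "(drop l B @ x # take k A) @ drop k A @ y # take l B \<in> permutations_of_set {1..n}"
      by (simp only: arcs_def permutations_of_set_def mem_Collect_eq prod.case)
    with q show ?case by (simp add: splits_def)
  next
    case (5 p)
    then obtain s1 s2 t1 t2 where p: "p = (s1 @ x # s2, t1 @ y # t2)"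
      by (auto simp: splits_def dest!: split_list)
    with 5 have "x \<notin> set s1" "y \<notin> set t1" by (auto simp: splits_def permutations_of_set_def)
    then show ?case by (simp add: p takeWhile_dropWhile_distinct)
  qed
  also have "\<dots> = (\<Sum>(A, B)\<in>arcs n x y. \<Sum>(k, l)\<in>{..length A} \<times> {..length B}.
      f (drop l B @ x # take k A) (drop k A @ y # take l B))"
    by (subst sum.Sigma[symmetric]) (auto simp: finite_arcs case_prod_beta)
  finally show ?thesis by (simp add: sum.cartesian_product)
qed

text \<open>The trace sees only the cyclic word and is constant over the cuts. The denominators
  factor at \<open>x\<close> and at \<open>y\<close>; regrouping the four factors by arc separates
  the sums over \<open>k\<close> and \<open>l\<close>, and each telescopes by
  \<open>sum_cut_open_chain\<close>.\<close>

lemma sum_splits_open_chains: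
  fixes T :: "nat \<Rightarrow> complex^'r^'r"
  assumes z: "inj_on z {1..n}"
  shows "(\<Sum>(s, s')\<in>splits n x y. trace (mat_prod_list (map T (s @ s'))) / (open_chain z s * open_chain z s')) =
    - (spb z x y)\<^sup>2 * (\<Sum>(A, B)\<in>arcs n x y.
      trace (mat_prod_list (map T (x # A @ y # B))) / closed_chain z (x # A @ y # B))"
proof -
  have "(\<Sum>k\<le>length A. \<Sum>l\<le>length B.
      trace (mat_prod_list (map T ((drop l B @ x # take k A) @ (drop k A @ y # take l B)))) /
      (open_chain z (drop l B @ x # take k A) * open_chain z (drop k A @ y # take l B))) =
    - (spb z x y)\<^sup>2 * (trace (mat_prod_list (map T (x # A @ y # B))) / closed_chain z (x # A @ y # B))"
    if AB: "(A, B) \<in> arcs n x y" for A B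
  proof -
    let ?t = "trace (mat_prod_list (map T (x # A @ y # B)))"
    have perm: "set (x # A @ y # B) = {1..n}" "distinct (x # A @ y # B)"
      using AB by (auto simp: arcs_def permutations_of_set_def)
    have nz: "open_chain z (x # A @ [y]) \<noteq> 0" "open_chain z (y # B @ [x]) \<noteq> 0"
      by (rule open_chain_nonzero[OF z]; use perm in auto)+
    have tr: "trace (mat_prod_list (map T ((drop l B @ x # take k A) @ (drop k A @ y # take l B)))) = ?t" for k l
    proof -
      have "trace (mat_prod_list (map T ((drop l B @ x # take k A) @ (drop k A @ y # take l B)))) =
        trace (mat_prod_list (map T (drop l B) @ map T (x # A @ y # take l B)))"
        by (metis append.assoc append_Cons append_take_drop_id map_append)
      also have "\<dots> = trace (mat_prod_list (map T (x # A @ y # take l B) @ map T (drop l B)))"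
        by (rule trace_mat_prod_list_swap)
      also have "\<dots> = ?t"
        by (metis append.assoc append_Cons append_take_drop_id map_append)
      finally show ?thesis .
    qed
    let ?a = "\<lambda>k. 1 / (open_chain z (x # take k A) * open_chain z (drop k A @ [y]))"
      and ?b = "\<lambda>l. 1 / (open_chain z (y # take l B) * open_chain z (drop l B @ [x]))"
    have "open_chain z (drop l B @ x # take k A) * open_chain z (drop k A @ y # take l B) =
        (open_chain z (drop l B @ [x]) * open_chain z (x # take k A)) *
        (open_chain z (drop k A @ [y]) * open_chain z (y # take l B))" for k l
      by (rule arg_cong2[of _ _ _ _ "(*)"]; rule open_chain_append)
    then have "?t / (open_chain z (drop l B @ x # take k A) * open_chain z (drop k A @ y # take l B)) =
        ?t * (?a k * ?b l)" for k l
      by (simp only:) (simp add: mult_ac)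
    then have "(\<Sum>k\<le>length A. \<Sum>l\<le>length B.
        trace (mat_prod_list (map T ((drop l B @ x # take k A) @ (drop k A @ y # take l B)))) /
        (open_chain z (drop l B @ x # take k A) * open_chain z (drop k A @ y # take l B))) =
      (\<Sum>k\<le>length A. \<Sum>l\<le>length B. ?t * (?a k * ?b l))"
      unfolding tr by (simp only:)
    also have "\<dots> = ?t * ((\<Sum>k\<le>length A. ?a k) * (\<Sum>l\<le>length B. ?b l))"
      by (subst sum_product) (simp only: sum_distrib_left)
    also have "\<dots> = ?t * (spb z x y * spb z y x) / closed_chain z (x # A @ y # B)"
      unfolding sum_cut_open_chain[OF nz(1)] sum_cut_open_chain[OF nz(2)] closed_chain_two_arcs by simp
    also have "spb z x y * spb z y x = - (spb z x y)\<^sup>2"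
      by (simp add: spb_def power2_eq_square algebra_simps)
    finally show ?thesis by simp
  qed
  then show ?thesis
    unfolding sum_splits sum_distrib_left by (intro sum.cong) auto
qed

text \<open>Each class contains exactly one word that starts with \<open>x\<close>, and its other
  letters split uniquely at \<open>y\<close>. Invariance of \<open>f\<close> under rotation makes
  the representative picked by \<open>SOME\<close> immaterial.\<close>

lemma sum_cyclic_orderings:
  assumes f: "\<And>k s. f (rotate k s) = f s"
    and xy: "x \<noteq> y" "x \<in> {1..n}" "y \<in> {1..n}"
  shows "(\<Sum>c\<in>cyclic_orderings n. f (SOME s. s \<in> c)) = (\<Sum>(A, B)\<in>arcs n x y. f (x # A @ y # B))"
proof -
  let ?C = "\<lambda>s. {s'. \<exists>k. s' = rotate k s}"
  have orderings: "cyclic_orderings n = ?C ` permutations_of_set {1..n}"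
    by (auto simp: cyclic_orderings_def quotient_def)
  have rotated: "?C (rotate k s) = ?C s" for k and s :: "nat list"
  proof (intro set_eqI iffI; clarsimp simp: rotate_rotate)
    fix m
    show "\<exists>j. rotate (m + k) s = rotate j s" by blast
  next
    fix m
    \<comment> \<open>The rotation sought is by \<open>m - k\<close>, which may be negative. Adding
      \<open>k\<close> full turns first makes the subtraction exact on natural numbers when
      \<open>s\<close> is nonempty.\<close>
    have "rotate m s = rotate (m + k * length s) s"
      by (metis mod_mult_self1 mult.commute rotate_conv_mod)
    show "\<exists>j. rotate m s = rotate (j + k) s"
    proof (cases "s = []")
      case False
      then have "m + k * length s = (m + k * length s - k) + k"
        by (cases s) (simp_all)
      then show ?thesis using \<open>rotate m s = _\<close> by metis
    qed simp
  qed
  have "bij_betw (\<lambda>(A, B). ?C (x # A @ y # B)) (arcs n x y) (cyclic_orderings n)"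
    unfolding bij_betw_def
  proof
    show "inj_on (\<lambda>(A, B). ?C (x # A @ y # B)) (arcs n x y)"
    proof (rule inj_onI, clarify)
      fix A B A' B'
      assume AB: "(A, B) \<in> arcs n x y" "(A', B') \<in> arcs n x y"
        and eq: "?C (x # A @ y # B) = ?C (x # A' @ y # B')"
      let ?s = "x # A @ y # B"
      have "x # A' @ y # B' \<in> ?C ?s" unfolding eq by (auto intro: exI[of _ 0])
      then obtain k where "x # A' @ y # B' = rotate k ?s" by blast
      then have k: "x # A' @ y # B' = rotate (k mod length ?s) ?s"
        by (simp only: rotate_conv_mod[symmetric])
      let ?m = "k mod length ?s"
      \<comment> \<open>Both words start with \<open>x\<close>, which occurs only once, so the
        rotation between them is trivial.\<close>
      have "?s ! ?m = (rotate ?m ?s) ! 0"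
        by (subst nth_rotate) simp_all
      also have "\<dots> = ?s ! 0" unfolding k[symmetric] by simp
      finally have "?m = 0"
        using AB(1) by (subst (asm) nth_eq_iff_index_eq) (auto simp: arcs_def permutations_of_set_def)
      with k have eq': "A' @ y # B' = A @ y # B" by simp
      moreover have "y \<notin> set A" "y \<notin> set A'"
        using AB by (auto simp: arcs_def permutations_of_set_def)
      ultimately show "A = A' \<and> B = B'"
        by (metis takeWhile_dropWhile_distinct list.inject)
    qed
    show "(\<lambda>(A, B). ?C (x # A @ y # B)) ` arcs n x y = cyclic_orderings n"
    proof (intro equalityI subsetI)
      fix c assume "c \<in> cyclic_orderings n"
      then obtain s where s: "s \<in> permutations_of_set {1..n}" and c: "c = ?C s"
        by (auto simp: orderings)
      from s xy have "x \<in> set s" by (simp add: permutations_of_set_def)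
      then obtain s1 s2 where s12: "s = s1 @ x # s2" by (meson split_list)
      then have rot: "rotate (length s1) s = x # s2 @ s1" by (simp add: rotate_append)
      from s xy have "y \<in> set (s2 @ s1)" by (auto simp: permutations_of_set_def s12)
      then obtain A B where AB: "s2 @ s1 = A @ y # B" by (meson split_list)
      have "rotate (length s1) s \<in> permutations_of_set {1..n}"
        using s by (simp add: permutations_of_set_def)
      then have "(A, B) \<in> arcs n x y" by (simp add: arcs_def rot AB)
      moreover have "c = ?C (x # A @ y # B)"
        using rotated[of "length s1" s] by (simp add: c rot AB)
      ultimately show "c \<in> (\<lambda>(A, B). ?C (x # A @ y # B)) ` arcs n x y"
        by (auto intro!: rev_image_eqI)
    qed (auto simp: orderings arcs_def)
  qed
  then have "(\<Sum>c\<in>cyclic_orderings n. f (SOME s. s \<in> c)) =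
    (\<Sum>p\<in>arcs n x y. f (SOME s. s \<in> (\<lambda>(A, B). ?C (x # A @ y # B)) p))"
    by (rule sum.reindex_bij_betw[symmetric])
  also have "\<dots> = (\<Sum>(A, B)\<in>arcs n x y. f (x # A @ y # B))"
  proof (rule sum.cong[OF refl], clarify)
    fix A B
    have "(SOME s. s \<in> ?C (x # A @ y # B)) \<in> ?C (x # A @ y # B)"
      by (rule someI[of _ "x # A @ y # B"]) (auto intro: exI[of _ 0])
    then show "f (SOME s. s \<in> ?C (x # A @ y # B)) = f (x # A @ y # B)"
      using f by auto
  qed
  finally show ?thesis .
qed

lemma parke_taylor_sum_arcs:
  assumes "x \<noteq> y" "x \<in> {1..n}" "y \<in> {1..n}"
  shows "parke_taylor_sum z T n = (\<Sum>(A, B)\<in>arcs n x y.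
    trace (mat_prod_list (map T (x # A @ y # B))) / closed_chain z (x # A @ y # B))"
  unfolding parke_taylor_sum_def Let_def
  by (rule sum_cyclic_orderings) (use assms in \<open>auto simp: rotate_map[symmetric] trace_mat_prod_list_rotate\<close>)

section \<open>The coefficient of the density\<close>

lemma eps_const_simps [simp]:
  "eps_const 0 = 0" "eps_const 1 = 1"
  "eps_const (a + b) = eps_const a + eps_const b"
  by (auto intro!: eps_eqI simp: eps_const_def zero_eps_def one_eps_def plus_eps_def)

text \<open>The convolution collapses to the subset \<open>V\<close>. Constants are the case
  \<open>V = {}\<close> and the parameters the case \<open>V = {i}\<close>; an infinite
  \<open>V\<close> gives zero because \<open>mk_eps\<close> truncates.\<close>

lemma eps_coeff_single_mult:
  "eps_coeff (mk_eps (\<lambda>U. if U = V then c else 0) * x) S =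
    (if finite V \<and> V \<subseteq> S then c * eps_coeff x (S - V) else 0)"
proof (cases "finite S")
  case True
  have "eps_coeff (mk_eps (\<lambda>U. if U = V then c else 0) * x) S =
      (\<Sum>T\<in>Pow S. eps_coeff (mk_eps (\<lambda>U. if U = V then c else 0)) T * eps_coeff x (S - T))"
    using True by (simp add: times_eps_def)
  also have "\<dots> = (\<Sum>T\<in>Pow S. if T = V then if finite V then c * eps_coeff x (S - V) else 0 else 0)"
    by (rule sum.cong) simp_all
  also have "\<dots> = (if finite V \<and> V \<subseteq> S then c * eps_coeff x (S - V) else 0)"
    using True by (simp add: sum.delta)
  finally show ?thesis .
qed simp

lemma eps_coeff_const_mult [simp]: "eps_coeff (eps_const c * x) S = c * eps_coeff x S"
  by (simp add: eps_const_def eps_coeff_single_mult)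

lemma eps_const_mult: "eps_const (a * b) = eps_const a * eps_const b"
  by (rule eps_eqI) (simp only: eps_coeff_const_mult, simp add: eps_const_def)

lemma eps_coeff_add [simp]: "eps_coeff (x + y) S = eps_coeff x S + eps_coeff y S"
  by (cases "finite S") (simp_all add: plus_eps_def)

lemma eps_coeff_zero [simp]: "eps_coeff 0 S = 0"
  by (simp add: zero_eps_def)

lemma eps_coeff_sum: "eps_coeff (\<Sum>i\<in>A. f i) S = (\<Sum>i\<in>A. eps_coeff (f i) S)"
  by (induction A rule: infinite_finite_induct) simp_all

lemma eps_const_sum: "eps_const (\<Sum>i\<in>A. f i) = (\<Sum>i\<in>A. eps_const (f i))"
  by (induction A rule: infinite_finite_induct) simp_all

lemma eps_coeff_var_mult:
  "eps_coeff (eps_var i * x) S = (if i \<in> S then eps_coeff x (S - {i}) else 0)"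
  by (simp add: eps_var_def eps_coeff_single_mult)

text \<open>A repeated letter annihilates the product, since each parameter squares to zero. This is
  how distinctness across two words is enforced.\<close>

lemma eps_coeff_monomial:
  "eps_coeff (prod_list (map eps_var s)) S = (if distinct s \<and> set s = S then 1 else 0)"
proof (induction s arbitrary: S)
  case Nil
  then show ?case by (auto simp: one_eps_def)
next
  case (Cons i s)
  have "i \<in> S \<and> distinct s \<and> set s = S - {i} \<longleftrightarrow> distinct (i # s) \<and> set (i # s) = S"
    by auto
  then show ?case by (simp add: eps_coeff_var_mult Cons.IH) blast
qed

lemma eps_coeff_deriv:
  "finite S \<Longrightarrow> i \<notin> S \<Longrightarrow> eps_coeff (eps_deriv i x) S = eps_coeff x (insert i S)"
  by (simp add: eps_deriv_def)

text \<open>Disjointness and distinctness keep every derivative out of the zero branch of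
  \<open>eps_deriv\<close>. For \<open>S = {}\<close> the iterated derivative at zero reads off the
  coefficient of \<open>set s\<close>.\<close>

lemma eps_coeff_foldr_deriv:
  assumes "finite S" "distinct s" "S \<inter> set s = {}"
  shows "eps_coeff (foldr eps_deriv s x) S = eps_coeff x (S \<union> set s)"
  using assms
proof (induction s arbitrary: S)
  case (Cons i s)
  then have "eps_coeff (foldr eps_deriv s x) (insert i S) = eps_coeff x (insert i S \<union> set s)"
    by (intro Cons.IH) auto
  with Cons.prems show ?case by (simp add: eps_coeff_deriv)
qed simp

section \<open>Matrices over the algebra of the parameters\<close>

lemma mat_scale_mult:
  fixes M N :: "'a::comm_semiring_1^'n^'n"
  shows "mat_scale a M ** mat_scale b N = mat_scale (a * b) (M ** N)"
  by (simp add: mat_scale_def matrix_matrix_mult_def vec_eq_iff sum_distrib_left mult_ac)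

lemma mat_scale_mat_scale: "mat_scale a (mat_scale b M) = mat_scale (a * b) M"
  by (simp add: mat_scale_def vec_eq_iff mult.assoc)

lemma sum_mat_scale: "(\<Sum>i\<in>A. mat_scale (f i) M) = mat_scale (\<Sum>i\<in>A. f i) M"
  by (simp add: mat_scale_def vec_eq_iff sum_distrib_right)

lemma trace_mat_scale: "trace (mat_scale a M) = a * trace M"
  by (simp add: mat_scale_def trace_def sum_distrib_left)

lemma trace_sum: "trace (\<Sum>i\<in>A. M i) = (\<Sum>i\<in>A. trace (M i))"
  by (simp add: trace_def) (rule sum.swap)

lemma sum_matrix_mult_sum:
  fixes M N :: "'i \<Rightarrow> 'a::semiring_1^'n^'n"
  shows "(\<Sum>i\<in>A. M i) ** (\<Sum>j\<in>B. N j) = (\<Sum>i\<in>A. \<Sum>j\<in>B. M i ** N j)"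
proof -
  have "(\<Sum>k\<in>UNIV. (\<Sum>i\<in>A. M i $ r $ k) * (\<Sum>j\<in>B. N j $ k $ s)) =
      (\<Sum>i\<in>A. \<Sum>j\<in>B. \<Sum>k\<in>UNIV. M i $ r $ k * N j $ k $ s)" for r s
    unfolding sum_product
    by (subst sum.swap, rule sum.cong[OF refl], subst sum.swap, rule refl)
  then show ?thesis by (simp add: matrix_matrix_mult_def vec_eq_iff)
qed

definition const_mat :: "complex^'r^'r \<Rightarrow> eps^'r^'r" where
  "const_mat M = (\<chi> r s. eps_const (M $ r $ s))"

lemma const_mat_mult: "const_mat M ** const_mat N = const_mat (M ** N)"
  by (simp add: const_mat_def matrix_matrix_mult_def vec_eq_iff eps_const_sum eps_const_mult)

lemma const_mat_one: "const_mat (mat 1) = mat 1"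
  by (simp add: const_mat_def mat_def vec_eq_iff)

lemma trace_const_mat: "trace (const_mat M) = eps_const (trace M)"
  by (simp add: const_mat_def trace_def eps_const_sum)

text \<open>Parameters and exponentials are scalars in a commutative ring and gather in front; only
  the colour matrices keep their order.\<close>

lemma mat_prod_list_seeds:
  "mat_prod_list (map (seed \<omega> z zb T X) s) =
    mat_scale (eps_const (\<Prod>i\<leftarrow>s. exp (\<i> * mom_dot (\<omega> i) (z i) (zb i) X)) * prod_list (map eps_var s))
      (const_mat (mat_prod_list (map T s)))"
proof (induction s)
  case Nil
  then show ?case by (simp add: const_mat_one mat_scale_def vec_eq_iff)
next
  case (Cons i s)
  then show ?case
    by (simp add: seed_def const_mat_def[symmetric] mat_scale_mult const_mat_mult eps_const_mult mult_ac)
qed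

section \<open>The perturbiner as a sum over words\<close>

lemma perturbiner_eq_sum:
  assumes "finite S"
  shows "perturbiner z \<Phi> S = (\<Sum>s | s \<noteq> [] \<and> distinct s \<and> set s \<subseteq> S.
    mat_scale (eps_const (1 / open_chain z s)) (mat_prod_list (map \<Phi> s)))"
proof -
  \<comment> \<open>A nonempty distinct word over \<open>S\<close> has length between 1 and
    \<open>card S\<close>, so grouping by length covers all of them, each once.\<close>
  have "{s. s \<noteq> [] \<and> distinct s \<and> set s \<subseteq> S} =
      (\<Union>k\<in>{1..card S}. {s. length s = k \<and> distinct s \<and> set s \<subseteq> S})" (is "_ = (\<Union>k\<in>_. ?L k)")
    using assms by (auto simp: Suc_le_eq distinct_card[symmetric] card_gt_0_iff intro!: card_mono)
  moreover have "finite (?L k)" for k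
    by (rule finite_subset[OF _ finite_lists_length_eq[OF assms, of k]]) auto
  ultimately show ?thesis
    unfolding perturbiner_def by (subst sum.UNION_disjoint[symmetric]) auto
qed

definition insertion_words :: "nat \<Rightarrow> nat \<Rightarrow> nat list set" where
  "insertion_words N I = {s. distinct s \<and> set s \<subseteq> insert I {1..N} \<and> I \<in> set s}"

lemma finite_distinct_lists: "finite S \<Longrightarrow> finite {s. distinct s \<and> set s \<subseteq> S}"
  by (rule finite_subset[OF _ finite_subset_distinct]) auto

lemma finite_insertion_words: "finite (insertion_words N I)"
  by (rule finite_subset[OF _ finite_distinct_lists[of "insert I {1..N}"]]) (auto simp: insertion_words_def)

text \<open>The words over the larger set that avoid \<open>I\<close> are exactly the ones
  subtracted.\<close>

lemma perturbiner_ins_eq_sum: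
  assumes "I \<notin> {1..N}"
  shows "perturbiner_ins z \<Phi> N I = (\<Sum>s\<in>insertion_words N I.
    mat_scale (eps_const (1 / open_chain z s)) (mat_prod_list (map \<Phi> s)))"
proof -
  let ?L = "\<lambda>S. {s. s \<noteq> [] \<and> distinct s \<and> set s \<subseteq> S}"
  have "?L (insert I {1..N}) = insertion_words N I \<union> ?L {1..N}" "insertion_words N I \<inter> ?L {1..N} = {}"
    using assms by (auto simp: insertion_words_def)
  moreover have "finite (?L {1..N})"
    by (rule finite_subset[OF _ finite_distinct_lists[of "{1..N}"]]) auto
  ultimately show ?thesis
    by (simp add: perturbiner_ins_def perturbiner_eq_sum sum.union_disjoint finite_insertion_words)
qed

text \<open>Each field strength is a scalar built from spinors times one matrix, so the indices
  contract on scalars alone. Both index pairs contribute \<open>spb z (N + 1) (N + 2)\<close>, and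
  the two halves make the denominator 4.\<close>

lemma mhv_density_eq_trace:
  "mhv_density \<omega> z zb T N X = eps_const ((spb z (N + 1) (N + 2))\<^sup>2 / 4) *
    trace (perturbiner_ins z (seed \<omega> z zb T X) N (N + 1) ** perturbiner_ins z (seed \<omega> z zb T X) N (N + 2))"
proof -
  let ?P = "\<lambda>I. perturbiner_ins z (seed \<omega> z zb T X) N I" and ?\<kappa> = "\<lambda>I. spinor (z I)"
  let ?up = "\<lambda>A B. \<Sum>C\<in>UNIV. \<Sum>D\<in>UNIV. levi_civita A C * levi_civita B D *
      (1 / 2 * ?\<kappa> (N + 1) $ C * ?\<kappa> (N + 1) $ D)"
  have up: "raise_indices (field_strength z (seed \<omega> z zb T X) N (N + 1)) A B =
      mat_scale (eps_const (?up A B)) (?P (N + 1))" for A B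
    by (simp only: raise_indices_def field_strength_def mat_scale_mat_scale eps_const_mult[symmetric]
        sum_mat_scale eps_const_sum)
  have "(\<Sum>A\<in>UNIV. \<Sum>B\<in>UNIV. ?up A B * (1 / 2 * ?\<kappa> (N + 2) $ A * ?\<kappa> (N + 2) $ B)) =
      (spb z (N + 1) (N + 2))\<^sup>2 / 4"
    by (simp add: sum_2 levi_civita_def spinor_def spb_def power2_eq_square field_simps)
  then show ?thesis
    unfolding mhv_density_def Let_def up
    by (simp only: field_strength_def mat_scale_mult eps_const_mult[symmetric] sum_mat_scale
        eps_const_sum[symmetric] trace_mat_scale)
qed

text \<open>Only pairs of words that use every index once reach the top monomial, and these form
  \<open>splits\<close>. The fourth power is the square from the spinors times the square from the
  cuts; the sign comes from the cuts.\<close>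

lemma eps_coeff_mhv_density:
  assumes z: "inj_on z {1..N + 2}"
  shows "eps_coeff (mhv_density \<omega> z zb T N X) {1..N + 2} =
    - (spb z (N + 1) (N + 2) ^ 4) / 4 * exp (\<i> * (\<Sum>i=1..N + 2. mom_dot (\<omega> i) (z i) (zb i) X)) *
    parke_taylor_sum z T (N + 2)"
proof -
  let ?I = "N + 1" and ?J = "N + 2" and ?W = "insertion_words N"
  let ?e = "\<lambda>i. exp (\<i> * mom_dot (\<omega> i) (z i) (zb i) X)"
  let ?E = "exp (\<i> * (\<Sum>i=1..N + 2. mom_dot (\<omega> i) (z i) (zb i) X))"
  let ?F = "\<lambda>s s'. trace (mat_prod_list (map T (s @ s'))) / (open_chain z s * open_chain z s')"
  \<comment> \<open>The plane waves commute, so every full word carries the same exponential, which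
    leaves the sum.\<close>
  have E: "(\<Prod>i\<leftarrow>s. ?e i) = ?E" if "distinct s" "set s = {1..N + 2}" for s
  proof -
    have "(\<Prod>i\<leftarrow>s. ?e i) = (\<Prod>i\<in>{1..N + 2}. ?e i)"
      using prod.distinct_set_conv_list[OF that(1), of ?e] that(2) by simp
    then show ?thesis by (simp only: exp_sum[symmetric] finite_atLeastAtMost sum_distrib_left)
  qed
  have "eps_coeff (trace (perturbiner_ins z (seed \<omega> z zb T X) N ?I ** perturbiner_ins z (seed \<omega> z zb T X) N ?J))
      {1..N + 2} =
    (\<Sum>s\<in>?W ?I. \<Sum>s'\<in>?W ?J. if distinct (s @ s') \<and> set (s @ s') = {1..N + 2} then ?E * ?F s s' else 0)"
  proof -
    let ?c = "\<lambda>s s'. 1 / open_chain z s * (1 / open_chain z s') * (\<Prod>i\<leftarrow>s @ s'. ?e i) *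
        trace (mat_prod_list (map T (s @ s')))"
    let ?m = "\<lambda>s. mat_scale (eps_const (1 / open_chain z s)) (mat_prod_list (map (seed \<omega> z zb T X) s))"
    have "trace (?m s ** ?m s') = eps_const (?c s s') * prod_list (map eps_var (s @ s'))" for s s'
      unfolding mat_prod_list_seeds mat_scale_mat_scale mat_scale_mult const_mat_mult trace_mat_scale
        trace_const_mat map_append mat_prod_list_append prod_list.append eps_const_mult
      by (simp only: mult_ac)
    then have "eps_coeff (trace (?m s ** ?m s')) {1..N + 2} =
        (if distinct (s @ s') \<and> set (s @ s') = {1..N + 2} then ?E * ?F s s' else 0)" for s s'
      using E[of "s @ s'"] by (simp only: eps_coeff_const_mult eps_coeff_monomial) simp
    moreover have "perturbiner_ins z (seed \<omega> z zb T X) N ?I = (\<Sum>s\<in>?W ?I. ?m s)"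
      "perturbiner_ins z (seed \<omega> z zb T X) N ?J = (\<Sum>s\<in>?W ?J. ?m s)"
      by (rule perturbiner_ins_eq_sum; simp)+
    ultimately show ?thesis
      by (simp only: sum_matrix_mult_sum trace_sum eps_coeff_sum)
  qed
  also have "\<dots> = (\<Sum>(s, s')\<in>splits (N + 2) ?I ?J. ?E * ?F s s')"
    unfolding sum.cartesian_product
  proof (rule sum.mono_neutral_cong_right)
    show "finite (?W ?I \<times> ?W ?J)" by (simp add: finite_insertion_words)
    show "splits (N + 2) ?I ?J \<subseteq> ?W ?I \<times> ?W ?J"
    proof (rule subrelI)
      fix s s' assume "(s, s') \<in> splits (N + 2) ?I ?J"
      then have h: "set s \<union> set s' = {1..N + 2}" "distinct s" "distinct s'" "set s \<inter> set s' = {}"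
        "?I \<in> set s" "?J \<in> set s'"
        by (auto simp: splits_def permutations_of_set_def)
      \<comment> \<open>As \<open>?J\<close> already lies in \<open>s'\<close>, disjointness keeps
        it out of \<open>s\<close>, which is then a word over \<open>?I\<close> and the positive
        gluons; likewise for \<open>s'\<close>.\<close>
      then have "?J \<notin> set s" "?I \<notin> set s'" by blast+
      moreover have "{1..N + 2} = insert ?I (insert ?J {1..N})" by auto
      with h(1) have "set s \<subseteq> insert ?I (insert ?J {1..N})" "set s' \<subseteq> insert ?I (insert ?J {1..N})"
        by blast+
      ultimately have "set s \<subseteq> insert ?I {1..N}" "set s' \<subseteq> insert ?J {1..N}" by blast+
      with h show "(s, s') \<in> ?W ?I \<times> ?W ?J" by (simp add: insertion_words_def)
    qed
  next
    let ?cond = "\<lambda>s s'. distinct (s @ s') \<and> set (s @ s') = {1..N + 2}"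
    have cond: "?cond s s' \<longleftrightarrow> (s, s') \<in> splits (N + 2) ?I ?J" if "(s, s') \<in> ?W ?I \<times> ?W ?J" for s s'
      using that unfolding splits_def permutations_of_set_def insertion_words_def by blast
    show "\<forall>p\<in>?W ?I \<times> ?W ?J - splits (N + 2) ?I ?J.
        (case p of (s, s') \<Rightarrow> if ?cond s s' then ?E * ?F s s' else 0) = 0"
    proof
      fix p assume "p \<in> ?W ?I \<times> ?W ?J - splits (N + 2) ?I ?J"
      moreover obtain s s' where p: "p = (s, s')" by (cases p)
      ultimately have "\<not> ?cond s s'" using cond[of s s'] by blast
      then show "(case p of (s, s') \<Rightarrow> if ?cond s s' then ?E * ?F s s' else 0) = 0"
        by (simp only: p prod.case if_False)
    qed
  next
    fix p assume "p \<in> splits (N + 2) ?I ?J"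
    then show "(case p of (s, s') \<Rightarrow> if distinct (s @ s') \<and> set (s @ s') = {1..N + 2} then ?E * ?F s s' else 0) =
        (case p of (s, s') \<Rightarrow> ?E * ?F s s')"
      by (auto simp: splits_def permutations_of_set_def)
  qed
  also have "\<dots> = ?E * (\<Sum>(s, s')\<in>splits (N + 2) ?I ?J. ?F s s')"
    by (simp add: sum_distrib_left case_prod_beta)
  also have "\<dots> = - ?E * (spb z ?I ?J)\<^sup>2 * parke_taylor_sum z T (N + 2)"
    unfolding sum_splits_open_chains[OF z] by (subst parke_taylor_sum_arcs[of ?I ?J]) auto
  finally show ?thesis
    unfolding mhv_density_eq_trace by (simp add: power2_eq_square power4_eq_xxxx)
qed

section \<open>Fourier inversion\<close>

text \<open>Lebesgue measure is the image of a product of one-dimensional measures, so the integral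
  factors over the coordinates. This reduces the Gaussian to dimension one.\<close>

lemma
  fixes f :: "real \<Rightarrow> 'b :: {real_normed_field,banach,second_countable_topology}"
    and h :: "'a::euclidean_space \<Rightarrow> real \<Rightarrow> 'b"
  assumes h: "\<And>b. b \<in> Basis \<Longrightarrow> integrable lborel (h b)"
  shows integrable_lborel_prod: "integrable lborel (\<lambda>x::'a. \<Prod>b\<in>Basis. h b (x \<bullet> b))"
    and integral_lborel_prod:
      "(\<integral>x. (\<Prod>b\<in>Basis. h b (x \<bullet> b)) \<partial>lborel) = (\<Prod>b\<in>Basis. \<integral>y. h b y \<partial>lborel)"
proof -
  interpret product_sigma_finite "\<lambda>b::'a. lborel :: real measure" ..
  have [measurable]: "h b \<in> borel_measurable borel" if "b \<in> Basis" for b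
    using borel_measurable_integrable[OF h[OF that]] by simp
  have [measurable]: "(\<lambda>x::'a. \<Prod>b\<in>Basis. h b (x \<bullet> b)) \<in> borel_measurable borel"
    by measurable
  have eq: "(\<Prod>b\<in>Basis. h b ((\<Sum>c\<in>Basis. f c *\<^sub>R c) \<bullet> b)) = (\<Prod>b\<in>Basis. h b (f b))" for f :: "'a \<Rightarrow> real"
    by (rule prod.cong) simp_all
  show "integrable lborel (\<lambda>x::'a. \<Prod>b\<in>Basis. h b (x \<bullet> b))"
    unfolding lborel_eq[where 'a='a]
    by (subst integrable_distr_eq) (auto simp: eq intro!: product_integrable_prod h)
  show "(\<integral>x. (\<Prod>b\<in>Basis. h b (x \<bullet> b)) \<partial>lborel) = (\<Prod>b\<in>Basis. \<integral>y. h b y \<partial>lborel)"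
    unfolding lborel_eq[where 'a='a]
    by (subst integral_distr) (auto simp: eq intro!: product_integral_prod h)
qed

text \<open>Lebesgue measure is a constant multiple of its own affine image. The substitution serves
  to rescale the Gaussian and to zoom in on a point.\<close>

lemma
  fixes f :: "'a::euclidean_space \<Rightarrow> 'b :: {banach,second_countable_topology}"
  assumes [measurable]: "f \<in> borel_measurable borel" and c: "c \<noteq> 0"
  shows integral_lborel_affine:
      "(\<integral>x. f x \<partial>lborel) = \<bar>c\<bar> ^ DIM('a) *\<^sub>R (\<integral>x. f (t + c *\<^sub>R x) \<partial>lborel)"
    and integrable_lborel_affine:
      "integrable lborel f \<Longrightarrow> integrable lborel (\<lambda>x. f (t + c *\<^sub>R x))"
proof -
  have D: "lborel = density (distr lborel borel (\<lambda>x::'a. t + c *\<^sub>R x)) (\<lambda>_. ennreal (\<bar>c\<bar> ^ DIM('a)))"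
    using lborel_affine[OF c, of t] by (simp add: ennreal_power)
  show "(\<integral>x. f x \<partial>lborel) = \<bar>c\<bar> ^ DIM('a) *\<^sub>R (\<integral>x. f (t + c *\<^sub>R x) \<partial>lborel)"
    by (subst D) (simp add: integral_density integral_distr)
  show "integrable lborel (\<lambda>x. f (t + c *\<^sub>R x))" if "integrable lborel f"
  proof -
    have "integrable (density (distr lborel borel (\<lambda>x::'a. t + c *\<^sub>R x)) (\<lambda>_. ennreal (\<bar>c\<bar> ^ DIM('a)))) f"
      using that by (subst D[symmetric])
    then have "integrable lborel (\<lambda>x. \<bar>c\<bar> ^ DIM('a) *\<^sub>R f (t + c *\<^sub>R x))"
      by (simp add: integrable_density integrable_distr_eq)
    then have "integrable lborel (\<lambda>x. inverse (\<bar>c\<bar> ^ DIM('a)) *\<^sub>R (\<bar>c\<bar> ^ DIM('a) *\<^sub>R f (t + c *\<^sub>R x)))"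
      by (rule integrable_scaleR_right)
    then show ?thesis using c by simp
  qed
qed

section \<open>The Gaussian and its Fourier transform\<close>

definition gaussian :: "'a::euclidean_space \<Rightarrow> real" where
  "gaussian x = exp (- (x \<bullet> x) / 2)"

lemma gaussian_measurable [measurable]: "gaussian \<in> borel_measurable borel"
  unfolding gaussian_def[abs_def] by measurable

lemma gaussian_pos: "gaussian x > 0" and gaussian_le_1: "gaussian x \<le> 1"
  and gaussian_minus [simp]: "gaussian (- x) = gaussian x"
  by (simp_all add: gaussian_def)

text \<open>Up to the factor \<open>sqrt (2 * pi)\<close> this is the characteristic function of the
  standard normal distribution.\<close>

lemma gaussian_real_fourier:
  fixes t :: real
  shows "integrable lborel (\<lambda>x::real. of_real (exp (- x\<^sup>2 / 2)) * exp (\<i> * of_real (t * x)))"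
    and "(\<integral>x. of_real (exp (- x\<^sup>2 / 2)) * exp (\<i> * of_real (t * x)) \<partial>lborel) =
      of_real (sqrt (2 * pi) * exp (- t\<^sup>2 / 2))"
proof -
  have eq: "of_real (exp (- x\<^sup>2 / 2)) * exp (\<i> * of_real (t * x)) =
      of_real (sqrt (2 * pi)) * (std_normal_density x *\<^sub>R exp (\<i> * of_real (t * x)))" for x :: real
    by (simp add: std_normal_density_def scaleR_conv_of_real)
  have "(\<integral>x. std_normal_density x *\<^sub>R exp (\<i> * of_real (t * x)) \<partial>lborel) =
      char std_normal_distribution t"
    by (simp add: char_def integral_density)
  then show "(\<integral>x. of_real (exp (- x\<^sup>2 / 2)) * exp (\<i> * of_real (t * x)) \<partial>lborel) =
      of_real (sqrt (2 * pi) * exp (- t\<^sup>2 / 2))"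
    unfolding eq by (simp only: integral_mult_right_zero) (simp add: char_std_normal_distribution)
  have "integrable lborel (\<lambda>x::real. std_normal_density x *\<^sub>R exp (\<i> * of_real (t * x)))"
  proof (rule Bochner_Integration.integrable_bound)
    show "integrable lborel std_normal_density" by simp
  qed (auto simp: normal_density_nonneg simp flip: of_real_mult)
  then show "integrable lborel (\<lambda>x::real. of_real (exp (- x\<^sup>2 / 2)) * exp (\<i> * of_real (t * x)))"
    unfolding eq by (rule integrable_mult_right)
qed

text \<open>Squared norm and inner product are sums over coordinates, so the integrand is a product
  of one-dimensional ones.\<close>

lemma gaussian_fourier:
  fixes v :: "'a::euclidean_space"
  shows "integrable lborel (\<lambda>x. of_real (gaussian x) * exp (\<i> * of_real (v \<bullet> x)))"
    and "(\<integral>x. of_real (gaussian x) * exp (\<i> * of_real (v \<bullet> x)) \<partial>lborel) =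
      of_real (sqrt (2 * pi) ^ DIM('a) * gaussian v)"
proof -
  have g: "gaussian x = (\<Prod>b\<in>Basis. exp (- (x \<bullet> b)\<^sup>2 / 2))" for x :: 'a
    by (simp add: gaussian_def euclidean_inner[of x x] power2_eq_square sum_negf sum_divide_distrib
        flip: exp_sum)
  have eq: "of_real (gaussian x) * exp (\<i> * of_real (v \<bullet> x)) =
    (\<Prod>b\<in>Basis. of_real (exp (- (x \<bullet> b)\<^sup>2 / 2)) * exp (\<i> * of_real ((v \<bullet> b) * (x \<bullet> b))))" for x
    by (simp add: g prod.distrib euclidean_inner[of v x] sum_distrib_left exp_sum)
  show "integrable lborel (\<lambda>x. of_real (gaussian x) * exp (\<i> * of_real (v \<bullet> x)))"
    unfolding eq by (rule integrable_lborel_prod) (rule gaussian_real_fourier)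
  show "(\<integral>x. of_real (gaussian x) * exp (\<i> * of_real (v \<bullet> x)) \<partial>lborel) =
      of_real (sqrt (2 * pi) ^ DIM('a) * gaussian v)"
    unfolding eq
    by (subst integral_lborel_prod) (simp_all only: gaussian_real_fourier, simp add: prod.distrib g)
qed

lemma gaussian_integrable: "integrable lborel (gaussian :: 'a::euclidean_space \<Rightarrow> real)"
  and gaussian_integral: "integral\<^sup>L lborel (\<lambda>x::'a. of_real (gaussian x) :: complex) = of_real (sqrt (2 * pi) ^ DIM('a))"
  using gaussian_fourier[of "0::'a"] by (simp_all add: gaussian_def[of 0] complex_of_real_integrable_eq)

text \<open>Widening the Gaussian by \<open>c\<close> narrows its transform by \<open>c\<close> and
  raises it by the Jacobian, so for growing \<open>c\<close> the transforms form an approximate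
  identity.\<close>

lemma gaussian_scaled_fourier:
  fixes v :: "'a::euclidean_space"
  assumes "c > 0"
  shows "(\<integral>x. of_real (gaussian (x /\<^sub>R c)) * exp (\<i> * of_real (v \<bullet> x)) \<partial>lborel) =
      of_real (c ^ DIM('a) * sqrt (2 * pi) ^ DIM('a) * gaussian (c *\<^sub>R v))"
  using assms gaussian_fourier(2)[of "c *\<^sub>R v"]
  by (subst integral_lborel_affine[where t=0 and c=c]) (simp_all add: scaleR_conv_of_real)

text \<open>\<open>\<psi>\<close> may be unbounded, so the substitution that concentrates the kernel is dominated only on a ball
around \<open>P\<close>; outside of it the kernel itself tends to zero uniformly.\<close>
lemma approximate_identity:
  fixes \<psi> :: "'a::euclidean_space \<Rightarrow> complex"
  assumes cont: "continuous_on UNIV \<psi>" and int: "integrable lborel \<psi>"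
  shows "(\<lambda>n. \<integral>q. of_real (real (Suc n) ^ DIM('a) * gaussian (real (Suc n) *\<^sub>R (P - q))) * \<psi> q \<partial>lborel)
    \<longlonglongrightarrow> of_real (sqrt (2 * pi) ^ DIM('a)) * \<psi> P"
proof -
  have [measurable]: "\<psi> \<in> borel_measurable borel"
    using cont by (rule borel_measurable_continuous_onI)
  define K :: "nat \<Rightarrow> 'a \<Rightarrow> real" where "K n q = real (Suc n) ^ DIM('a) * gaussian (real (Suc n) *\<^sub>R (P - q))" for n q
  have Kpos: "K n q \<ge> 0" for n q by (simp add: K_def less_imp_le[OF gaussian_pos])
  have [measurable]: "K n \<in> borel_measurable borel" for n unfolding K_def[abs_def] by measurable
  \<comment> \<open>Compactness of the ball bounds \<open>\<psi>\<close> on it. Outside, the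
    distance to \<open>P\<close> is at least 1, which \<open>KD\<close> turns into decay of the
    kernel.\<close>
  define B where "B = cball P 1"
  have [measurable]: "B \<in> sets borel" by (simp add: B_def)
  have "bounded (\<psi> ` B)" unfolding B_def
    by (intro compact_imp_bounded compact_continuous_image continuous_on_subset[OF cont]) auto
  then obtain M where M: "\<And>q. q \<in> B \<Longrightarrow> norm (\<psi> q) \<le> M"
    unfolding bounded_iff by auto
  have M0: "M \<ge> 0" using M[of P] norm_ge_zero[of "\<psi> P"] by (simp add: B_def del: norm_ge_zero)
  have Kb: "K n q \<le> real (Suc n) ^ DIM('a)" for n q
    using gaussian_le_1 by (simp add: K_def mult_left_le)
  have intK: "integrable lborel (\<lambda>q. of_real (K n q) * \<psi> q)" for n
    by (rule Bochner_Integration.integrable_bound[OF integrable_mult_right[OF integrable_norm[OF int], of "real (Suc n) ^ DIM('a)"]])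
      (use Kb Kpos in \<open>auto simp: norm_mult intro!: mult_right_mono\<close>)
  have near: "(\<lambda>n. \<integral>q. indicator B q *\<^sub>R (of_real (K n q) * \<psi> q) \<partial>lborel)
      \<longlonglongrightarrow> of_real (sqrt (2 * pi) ^ DIM('a)) * \<psi> P"
  proof -
    \<comment> \<open>Substituting \<open>q = ?f n y\<close> freezes the kernel to
      \<open>gaussian y\<close>, as the Jacobian cancels the power of \<open>Suc n\<close>. The
      limit then acts on \<open>\<psi>\<close> and the indicator only.\<close>
    let ?f = "\<lambda>n y. P + inverse (real (Suc n)) *\<^sub>R y"
    have "(\<integral>q. indicator B q *\<^sub>R (of_real (K n q) * \<psi> q) \<partial>lborel) =
      (\<integral>y. indicator B (?f n y) *\<^sub>R (of_real (gaussian y) * \<psi> (?f n y)) \<partial>lborel)" for n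
    proof -
      have K: "K n (?f n y) = real (Suc n) ^ DIM('a) * gaussian y" for y
        by (simp add: K_def del: of_nat_Suc)
      have cancel: "of_nat (Suc n) ^ k * (inverse (of_nat (Suc n) ^ k) * w) = w" for k and w :: complex
        by (simp del: of_nat_Suc)
      show ?thesis
        by (subst integral_lborel_affine[where t=P and c="inverse (real (Suc n))"])
          (simp_all add: K power_inverse scaleR_conv_of_real mult_ac cancel
            del: of_nat_Suc flip: integral_mult_right_zero)
    qed
    moreover have "(\<lambda>n. \<integral>y. indicator B (?f n y) *\<^sub>R (of_real (gaussian y) * \<psi> (?f n y)) \<partial>lborel)
      \<longlonglongrightarrow> integral\<^sup>L lborel (\<lambda>y::'a. of_real (gaussian y) * \<psi> P)"
    proof (rule integral_dominated_convergence[where w="\<lambda>y::'a. gaussian y * M"])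
      show "AE y in lborel. (\<lambda>n. indicator B (?f n y) *\<^sub>R (of_real (gaussian y) * \<psi> (?f n y)))
        \<longlonglongrightarrow> of_real (gaussian y) * \<psi> P"
      proof (rule AE_I2)
        fix y :: 'a
        have lim: "(\<lambda>n. ?f n y) \<longlonglongrightarrow> P + 0 *\<^sub>R y"
          by (intro tendsto_intros LIMSEQ_inverse_real_of_nat)
        then have lim: "(\<lambda>n. ?f n y) \<longlonglongrightarrow> P" by simp
        have "eventually (\<lambda>n. ?f n y \<in> ball P 1) sequentially"
          using lim by (rule topological_tendstoD) auto
        then have ev: "eventually (\<lambda>n. of_real (gaussian y) * \<psi> (?f n y) =
            indicator B (?f n y) *\<^sub>R (of_real (gaussian y) * \<psi> (?f n y))) sequentially"
          by eventually_elim (auto simp: B_def indicator_def dist_norm)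
        have "(\<lambda>n. of_real (gaussian y) * \<psi> (?f n y)) \<longlonglongrightarrow> of_real (gaussian y) * \<psi> P"
          by (intro tendsto_intros continuous_on_tendsto_compose[OF cont lim]) auto
        then show "(\<lambda>n. indicator B (?f n y) *\<^sub>R (of_real (gaussian y) * \<psi> (?f n y)))
            \<longlonglongrightarrow> of_real (gaussian y) * \<psi> P"
          using ev by (rule Lim_transform_eventually)
      qed
      show "AE y in lborel. norm (indicator B (?f n y) *\<^sub>R (of_real (gaussian y) * \<psi> (?f n y)))
        \<le> gaussian y * M" for n
        using M M0
        by (intro AE_I2) (auto simp: indicator_def norm_mult abs_of_pos[OF gaussian_pos]
            intro!: mult_left_mono mult_nonneg_nonneg less_imp_le[OF gaussian_pos])
    qed (auto intro!: gaussian_integrable)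
    ultimately show ?thesis
      using gaussian_integral[where 'a='a] by simp
  qed
  \<comment> \<open>With \<open>c = Suc n\<close>, the inequality
    \<open>2 * c - 1 \<le> c\<^sup>2\<close> bounds \<open>exp (- c\<^sup>2 / 2)\<close> by
    \<open>exp (1 / 2 - c)\<close>, so a power against a plain exponential is enough.\<close>
  define D where "D n = real (Suc n) ^ DIM('a) / exp (real (Suc n)) * exp (1 / 2)" for n
  have KD: "K n q \<le> D n" if "q \<notin> B" for n q
  proof -
    have reorder: "- X / 2 \<le> 1 / 2 - c" if "c\<^sup>2 * 1 \<le> X" "2 * c - 1 \<le> c\<^sup>2" for c X :: real
      using that by simp
    have "1 \<le> norm (P - q)" using that by (simp add: B_def dist_norm)
    then have "1 * 1 \<le> norm (P - q) * norm (P - q)" by (intro mult_mono) auto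
    then have "(real (Suc n))\<^sup>2 * 1 \<le> (real (Suc n))\<^sup>2 * ((P - q) \<bullet> (P - q))"
      by (intro mult_left_mono) (auto simp: power2_norm_eq_inner[symmetric] power2_eq_square)
    moreover have "2 * real (Suc n) - 1 \<le> (real (Suc n))\<^sup>2"
      using zero_le_power2[of "real (Suc n) - 1"]
      by (simp add: power2_eq_square algebra_simps)
    ultimately have "- ((real (Suc n))\<^sup>2 * ((P - q) \<bullet> (P - q))) / 2 \<le> 1 / 2 - real (Suc n)"
      by (rule reorder)
    then have "gaussian (real (Suc n) *\<^sub>R (P - q)) \<le> exp (1 / 2 - real (Suc n))"
      by (simp add: gaussian_def power2_eq_square mult.assoc del: of_nat_Suc)
    then have "K n q \<le> real (Suc n) ^ DIM('a) * exp (1 / 2 - real (Suc n))"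
      unfolding K_def by (intro mult_left_mono) auto
    then show ?thesis by (simp add: D_def exp_diff del: of_nat_Suc)
  qed
  have far: "(\<lambda>n. \<integral>q. indicator (- B) q *\<^sub>R (of_real (K n q) * \<psi> q) \<partial>lborel) \<longlonglongrightarrow> 0"
  proof (rule Lim_null_comparison[OF always_eventually])
    show "\<forall>n. norm (\<integral>q. indicator (- B) q *\<^sub>R (of_real (K n q) * \<psi> q) \<partial>lborel) \<le>
      D n * (\<integral>q. norm (\<psi> q) \<partial>lborel)"
    proof
      fix n
      have "D n \<ge> 0" by (simp add: D_def)
      then have "norm (indicator (- B) q *\<^sub>R (of_real (K n q) * \<psi> q)) \<le> D n * norm (\<psi> q)" for q
        using KD[of q n] Kpos[of n q]
        by (auto simp: indicator_def norm_mult intro!: mult_right_mono)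
      then have "norm (\<integral>q. indicator (- B) q *\<^sub>R (of_real (K n q) * \<psi> q) \<partial>lborel) \<le>
        (\<integral>q. D n * norm (\<psi> q) \<partial>lborel)"
        using int by (intro Bochner_Integration.integral_norm_bound_integral integrable_mult_indicator[OF _ intK]) auto
      then show "norm (\<integral>q. indicator (- B) q *\<^sub>R (of_real (K n q) * \<psi> q) \<partial>lborel) \<le>
        D n * (\<integral>q. norm (\<psi> q) \<partial>lborel)" by simp
    qed
    have "(\<lambda>n. real (Suc n) ^ DIM('a) / exp (real (Suc n))) \<longlonglongrightarrow> 0"
      by (rule filterlim_compose[OF tendsto_power_div_exp_0])
        (rule filterlim_compose[OF filterlim_real_sequentially filterlim_Suc])
    then have "D \<longlonglongrightarrow> 0"
      unfolding D_def[abs_def] by (rule tendsto_mult_left_zero)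
    then show "(\<lambda>n. D n * (\<integral>q. norm (\<psi> q) \<partial>lborel)) \<longlonglongrightarrow> 0"
      by (rule tendsto_mult_left_zero)
  qed
  have split: "(\<integral>q. of_real (K n q) * \<psi> q \<partial>lborel) =
    (\<integral>q. indicator B q *\<^sub>R (of_real (K n q) * \<psi> q) \<partial>lborel) +
    (\<integral>q. indicator (- B) q *\<^sub>R (of_real (K n q) * \<psi> q) \<partial>lborel)" for n
  proof -
    have "of_real (K n q) * \<psi> q = indicator B q *\<^sub>R (of_real (K n q) * \<psi> q) +
        indicator (- B) q *\<^sub>R (of_real (K n q) * \<psi> q)" for q
      by (simp add: indicator_def)
    then have "(\<integral>q. of_real (K n q) * \<psi> q \<partial>lborel) = (\<integral>q. indicator B q *\<^sub>R (of_real (K n q) * \<psi> q) +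
        indicator (- B) q *\<^sub>R (of_real (K n q) * \<psi> q) \<partial>lborel)" by (rule Bochner_Integration.integral_cong[OF refl])
    also have "\<dots> = (\<integral>q. indicator B q *\<^sub>R (of_real (K n q) * \<psi> q) \<partial>lborel) +
        (\<integral>q. indicator (- B) q *\<^sub>R (of_real (K n q) * \<psi> q) \<partial>lborel)"
      by (intro Bochner_Integration.integral_add integrable_mult_indicator intK) auto
    finally show ?thesis .
  qed
  have "(\<lambda>n. \<integral>q. of_real (K n q) * \<psi> q \<partial>lborel) \<longlonglongrightarrow> of_real (sqrt (2 * pi) ^ DIM('a)) * \<psi> P"
    unfolding split using tendsto_add[OF near far] by simp
  then show ?thesis unfolding K_def .
qed

text \<open>Inserting \<open>F\<close> as an integral gives a double integral that need not converge
  absolutely, so a Gaussian of width \<open>Suc n\<close> is put in. Dominated convergence removes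
  it on one side; on the other, exchanging the integrals leaves an approximate identity at
  \<open>P\<close>. The two limits must agree.\<close>

theorem fourier_inversion:
  fixes \<psi> :: "'a::euclidean_space \<Rightarrow> complex"
  defines "F \<equiv> \<lambda>x. \<integral>q. \<psi> q * exp (- \<i> * of_real (q \<bullet> x)) \<partial>lborel"
  assumes cont: "continuous_on UNIV \<psi>" and int: "integrable lborel \<psi>" and intF: "integrable lborel F"
  shows "(\<integral>x. exp (\<i> * of_real (P \<bullet> x)) * F x \<partial>lborel) = (2 * of_real pi) ^ DIM('a) * \<psi> P"
proof (rule LIMSEQ_unique)
  have [measurable]: "\<psi> \<in> borel_measurable borel"
    using cont by (rule borel_measurable_continuous_onI)
  have [measurable]: "F \<in> borel_measurable borel"
    using borel_measurable_integrable[OF intF] by simp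
  let ?c = "\<lambda>n. real (Suc n)"
  let ?G = "\<lambda>n. \<integral>x. of_real (gaussian (x /\<^sub>R ?c n)) * (exp (\<i> * of_real (P \<bullet> x)) * F x) \<partial>lborel"
  show "?G \<longlonglongrightarrow> (\<integral>x. exp (\<i> * of_real (P \<bullet> x)) * F x \<partial>lborel)"
  proof (rule integral_dominated_convergence[where w="\<lambda>x. norm (F x)"])
    show "AE x in lborel. (\<lambda>n. of_real (gaussian (x /\<^sub>R ?c n)) * (exp (\<i> * of_real (P \<bullet> x)) * F x))
      \<longlonglongrightarrow> exp (\<i> * of_real (P \<bullet> x)) * F x"
    proof (rule AE_I2)
      fix x :: 'a
      have "(\<lambda>n. gaussian (x /\<^sub>R ?c n)) \<longlonglongrightarrow> exp (- ((0 *\<^sub>R x) \<bullet> (0 *\<^sub>R x)) / 2)"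
        unfolding gaussian_def by (intro tendsto_intros LIMSEQ_inverse_real_of_nat) auto
      then have "(\<lambda>n. of_real (gaussian (x /\<^sub>R ?c n)) * (exp (\<i> * of_real (P \<bullet> x)) * F x))
        \<longlonglongrightarrow> of_real (exp (- ((0 *\<^sub>R x) \<bullet> (0 *\<^sub>R x)) / 2)) * (exp (\<i> * of_real (P \<bullet> x)) * F x)"
        by (intro tendsto_intros)
      then show "(\<lambda>n. of_real (gaussian (x /\<^sub>R ?c n)) * (exp (\<i> * of_real (P \<bullet> x)) * F x))
        \<longlonglongrightarrow> exp (\<i> * of_real (P \<bullet> x)) * F x" by simp
    qed
    show "AE x in lborel. norm (of_real (gaussian (x /\<^sub>R ?c n)) * (exp (\<i> * of_real (P \<bullet> x)) * F x))
      \<le> norm (F x)" for n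
      using gaussian_le_1
      by (intro AE_I2)
        (auto simp: norm_mult abs_of_pos[OF gaussian_pos]
          intro!: mult_left_le_one_le less_imp_le[OF gaussian_pos])
  qed (use intF in auto)
  have "?G n = of_real (sqrt (2 * pi) ^ DIM('a)) *
    (\<integral>q. of_real (?c n ^ DIM('a) * gaussian (?c n *\<^sub>R (P - q))) * \<psi> q \<partial>lborel)" for n
  proof -
    let ?g = "\<lambda>x::'a. gaussian (x /\<^sub>R ?c n)"
    have intg: "integrable lborel ?g"
      using integrable_lborel_affine[where f="gaussian::'a \<Rightarrow> real" and t=0 and c="inverse (?c n)"]
        gaussian_integrable by simp
    let ?H = "\<lambda>x q. of_real (?g x) * (exp (\<i> * of_real (P \<bullet> x)) * (\<psi> q * exp (- \<i> * of_real (q \<bullet> x))))"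
    \<comment> \<open>The phases have modulus 1, so the norm is an integrable function of
      \<open>x\<close> times an integrable function of \<open>q\<close>, as Fubini requires.\<close>
    have nH: "norm (?H x q) = ?g x * norm (\<psi> q)" for x q
      by (simp add: norm_mult abs_of_pos[OF gaussian_pos])
    have "integrable (lborel \<Otimes>\<^sub>M lborel) (case_prod ?H)"
    proof (rule lborel_pair.Fubini_integrable)
      show "integrable lborel (\<lambda>x. \<integral>q. norm (case (x, q) of (x, q) \<Rightarrow> ?H x q) \<partial>lborel)"
        using intg by (simp only: prod.case nH) simp
      show "AE x in lborel. integrable lborel (\<lambda>q. case (x, q) of (x, q) \<Rightarrow> ?H x q)"
      proof (rule AE_I2)
        fix x
        show "integrable lborel (\<lambda>q. case (x, q) of (x, q) \<Rightarrow> ?H x q)"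
          by (rule Bochner_Integration.integrable_bound[OF integrable_mult_right[OF integrable_norm[OF int], of "?g x"]])
            (simp_all only: prod.case nH, auto simp: abs_mult abs_of_pos[OF gaussian_pos])
      qed
    qed measurable
    then have "(\<integral>q. (\<integral>x. ?H x q \<partial>lborel) \<partial>lborel) = (\<integral>x. (\<integral>q. ?H x q \<partial>lborel) \<partial>lborel)"
      by (rule lborel_pair.Fubini_integral)
    also have "\<dots> = ?G n"
      by (simp add: F_def)
    finally have "?G n = (\<integral>q. (\<integral>x. ?H x q \<partial>lborel) \<partial>lborel)" ..
    also have "(\<lambda>q. \<integral>x. ?H x q \<partial>lborel) =
      (\<lambda>q. of_real (sqrt (2 * pi) ^ DIM('a)) * (of_real (?c n ^ DIM('a) * gaussian (?c n *\<^sub>R (P - q))) * \<psi> q))"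
    proof
      fix q
      have "(\<integral>x. ?H x q \<partial>lborel) = (\<integral>x. (of_real (?g x) * exp (\<i> * of_real ((P - q) \<bullet> x))) * \<psi> q \<partial>lborel)"
        by (intro Bochner_Integration.integral_cong)
          (simp_all add: inner_diff_left exp_diff exp_minus field_simps)
      also have "\<dots> = (\<integral>x. of_real (?g x) * exp (\<i> * of_real ((P - q) \<bullet> x)) \<partial>lborel) * \<psi> q"
        by simp
      also have "\<dots> = of_real (sqrt (2 * pi) ^ DIM('a)) *
          (of_real (?c n ^ DIM('a) * gaussian (?c n *\<^sub>R (P - q))) * \<psi> q)"
        by (subst gaussian_scaled_fourier) (simp_all add: mult_ac)
      finally show "(\<integral>x. ?H x q \<partial>lborel) = of_real (sqrt (2 * pi) ^ DIM('a)) *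
          (of_real (?c n ^ DIM('a) * gaussian (?c n *\<^sub>R (P - q))) * \<psi> q)" .
    qed
    finally show ?thesis by simp
  qed
  \<comment> \<open>One power of \<open>sqrt (2 * pi)\<close> comes from the transform of the
    Gaussian, the other from the total mass of the kernel.\<close>
  then have "?G \<longlonglongrightarrow> of_real (sqrt (2 * pi) ^ DIM('a)) * (of_real (sqrt (2 * pi) ^ DIM('a)) * \<psi> P)"
    by (simp only:) (intro tendsto_mult tendsto_const approximate_identity[OF cont int])
  also have "of_real (sqrt (2 * pi) ^ DIM('a)) * (of_real (sqrt (2 * pi) ^ DIM('a)) * \<psi> P) =
      of_real ((sqrt (2 * pi) * sqrt (2 * pi)) ^ DIM('a)) * \<psi> P"
    by (simp only: power_mult_distrib of_real_mult mult.assoc)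
  also have "\<dots> = (2 * of_real pi) ^ DIM('a) * \<psi> P"
    by simp
  finally show "?G \<longlonglongrightarrow> (2 * of_real pi) ^ DIM('a) * \<psi> P" .
qed

section \<open>The amplitude\<close>

theorem mainTheorem5:
  fixes N :: nat
    and \<omega> z zb :: "nat \<Rightarrow> complex"
    and br :: "'g::real_vector \<Rightarrow> 'g \<Rightarrow> 'g"
    and \<rho> :: "'g \<Rightarrow> complex^'r^'r"
    and t :: "'c \<Rightarrow> 'g"
    and a :: "nat \<Rightarrow> 'c"
    and T :: "nat \<Rightarrow> complex^'r^'r"
  assumes "N \<ge> 1"
    and "\<And>i. i \<in> {1..N + 2} \<Longrightarrow> \<omega> i \<noteq> 0"
    and "inj_on z {1..N + 2}"
    and "lie_bracket br"
    and "lie_representation br \<rho>"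
    and "\<And>i. T i = \<rho> (t (a i))"
  shows
    "(\<forall>\<iota> p \<psi>. real_form \<iota> \<longrightarrow>
        (\<forall>i\<in>{1..N + 2}. \<forall>x. mom_dot (\<omega> i) (z i) (zb i) (\<iota> x) = of_real (p i \<bullet> x)) \<longrightarrow>
        test_function \<psi> \<longrightarrow>
        mhv_amplitude \<omega> z zb T N \<iota> \<psi> =
          \<i> * (2 * of_real pi) ^ 4 * delta4 (\<Sum>i=1..N + 2. p i) \<psi> *
          spb z (N + 1) (N + 2) ^ 4 * parke_taylor_sum z T (N + 2))
     \<and> (\<forall>X. eps_coeff (eps_const (- 4 * \<i>) * mhv_density \<omega> z zb T N X) {1..N + 2} =
          \<i> * exp (\<i> * (\<Sum>i=1..N + 2. mom_dot (\<omega> i) (z i) (zb i) X)) *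
          spb z (N + 1) (N + 2) ^ 4 * parke_taylor_sum z T (N + 2))"
proof (intro conjI allI impI)
  fix X
  show "eps_coeff (eps_const (- 4 * \<i>) * mhv_density \<omega> z zb T N X) {1..N + 2} =
      \<i> * exp (\<i> * (\<Sum>i=1..N + 2. mom_dot (\<omega> i) (z i) (zb i) X)) *
      spb z (N + 1) (N + 2) ^ 4 * parke_taylor_sum z T (N + 2)"
    unfolding eps_coeff_const_mult eps_coeff_mhv_density[OF assms(3)] by simp
next
  fix \<iota> :: "real^4 \<Rightarrow> lightcone" and p and \<psi> :: "real^4 \<Rightarrow> complex"
  assume p: "\<forall>i\<in>{1..N + 2}. \<forall>x. mom_dot (\<omega> i) (z i) (zb i) (\<iota> x) = of_real (p i \<bullet> x)"
    and \<psi>: "test_function \<psi>"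
  let ?P = "\<Sum>i=1..N + 2. p i"
  \<comment> \<open>The factor \<open>- 1 / 4\<close> in \<open>?C\<close> meets the prefactor
    \<open>- 4 * \<i>\<close> of the amplitude and leaves \<open>\<i>\<close>.\<close>
  let ?C = "- (spb z (N + 1) (N + 2) ^ 4) / 4 * parke_taylor_sum z T (N + 2)"
  have "(\<Sum>i=1..N + 2. mom_dot (\<omega> i) (z i) (zb i) (\<iota> x)) = of_real (?P \<bullet> x)" for x
    unfolding inner_sum_left of_real_sum using p by (intro sum.cong) auto
  then have coeff: "eps_coeff (mhv_density \<omega> z zb T N (\<iota> x)) {1..N + 2} = ?C * exp (\<i> * of_real (?P \<bullet> x))" for x
    unfolding eps_coeff_mhv_density[OF assms(3)] by simp
  \<comment> \<open>All \<open>N + 2\<close> derivatives together select the coefficient of the full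
    index set, which is a constant times the plane wave of the total momentum.\<close>
  have "{1..<N + 3} = {1..N + 2}" by auto
  then have "mhv_amplitude \<omega> z zb T N \<iota> \<psi> =
      - 4 * \<i> * (\<integral>x. ?C * (exp (\<i> * of_real (?P \<bullet> x)) * fourier \<psi> x) \<partial>lborel)"
    unfolding mhv_amplitude_def eps_at_zero_def
    by (subst eps_coeff_foldr_deriv)
      (simp_all only: set_upt Un_empty_left spacetime_integral_def eps_coeff_mk finite_atLeastAtMost
        if_True coeff mult.assoc finite.emptyI distinct_upt Int_empty_left)
  also have "(\<integral>x. ?C * (exp (\<i> * of_real (?P \<bullet> x)) * fourier \<psi> x) \<partial>lborel) =
      ?C * (\<integral>x. exp (\<i> * of_real (?P \<bullet> x)) * fourier \<psi> x \<partial>lborel)"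
    by (rule integral_mult_right_zero)
  \<comment> \<open>The conditions in \<open>test_function\<close> are the hypotheses of Fourier
    inversion, here in dimension 4; evaluation at the total momentum is the delta
    distribution.\<close>
  also have "(\<integral>x. exp (\<i> * of_real (?P \<bullet> x)) * fourier \<psi> x \<partial>lborel) = (2 * of_real pi) ^ 4 * \<psi> ?P"
    using fourier_inversion[of \<psi> ?P] \<psi> by (simp add: test_function_def fourier_def[abs_def])
  finally show "mhv_amplitude \<omega> z zb T N \<iota> \<psi> =
      \<i> * (2 * of_real pi) ^ 4 * delta4 ?P \<psi> * spb z (N + 1) (N + 2) ^ 4 * parke_taylor_sum z T (N + 2)"
    by (simp add: delta4_def)
qed

end
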